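(* Let $p\ge 1$ be an integer and let $V=S^p\mathbb{R}^2$ be equipped with the Bombieri inner product. Let $X\subset V$ be the manifold of all non-zero elements of the form $\pm u^p$ with $u\in\mathbb{R}^2$. When $v\in V$ is drawn from the standard Gaussian distribution relative to the Bombieri norm, the expected number of critical points on $X$ of $d_v(x)=\|v-x\|^2$ equals $$\sqrt{3p-2}.$$
   Context: $S^p\mathbb{R}^2$ is the space of homogeneous polynomials of degree $p$ in the standard basis $e_1,e_2$ of $\mathbb{R}^2$. The Bombieri inner product is the one in which the monomials $e_1^{\alpha_1}e_2^{\alpha_2}$ ($\alpha_1+\alpha_2=p$) form an orthogonal basis with squared norms $\frac{\alpha_1!\,\alpha_2!}{p!}$. The standard Gaussian distribution relative to this norm is the one for which the coordinates of $v$ in an orthonormal basis are independent standard normal variables. For $u=t_1e_1+t_2e_2$, $u^p$ denotes the polynomial $(t_1e_1+t_2e_2)^p$. A point $x\in X$ is a critical point of $d_v$ on $X$ if $v-x\perp T_xX$. *)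

theory Defs
  imports "HOL-Probability.Probability" "HOL-Library.Poly_Mapping"
begin

text \<open>
  Polynomials in \<open>e\<^sub>1, e\<^sub>2\<close> are finitely supported maps from exponent pairs to \<open>real\<close>; the
  ring structure (convolution product) is the one of \<open>Poly_Mapping\<close>.
\<close>

type_synonym poly2 = "(nat \<times> nat) \<Rightarrow>\<^sub>0 real"

definition const2 :: "real \<Rightarrow> poly2"
  where "const2 c = Poly_Mapping.single (0, 0) c"

definition e\<^sub>1 :: poly2
  where "e\<^sub>1 = Poly_Mapping.single (1, 0) 1"

definition e\<^sub>2 :: poly2
  where "e\<^sub>2 = Poly_Mapping.single (0, 1) 1"

definition homogeneous_polys :: "nat \<Rightarrow> poly2 set"
  where "homogeneous_polys p = {f. \<forall>(a, b) \<in> Poly_Mapping.keys f. a + b = p}"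

definition bombieri_inner :: "nat \<Rightarrow> poly2 \<Rightarrow> poly2 \<Rightarrow> real"
  where "bombieri_inner p f g =
    (\<Sum>(a, b) \<in> {(a, b). a + b = p}.
      fact a * fact b / fact p * Poly_Mapping.lookup f (a, b) * Poly_Mapping.lookup g (a, b))"

text \<open>\<open>S\<^sup>p\<real>\<^sup>2\<close> has dimension \<open>p + 1\<close>, so its bases are indexed by \<open>{..p}\<close>.\<close>

definition bombieri_orthonormal_basis :: "nat \<Rightarrow> (nat \<Rightarrow> poly2) \<Rightarrow> bool"
  where "bombieri_orthonormal_basis p b \<longleftrightarrow>
    (\<forall>i\<le>p. b i \<in> homogeneous_polys p) \<and>
    (\<forall>i\<le>p. \<forall>j\<le>p. bombieri_inner p (b i) (b j) = (if i = j then 1 else 0)) \<and>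
    (\<forall>f\<in>homogeneous_polys p. \<exists>c. f = (\<Sum>i\<le>p. const2 (c i) * b i))"

text \<open>
  \<open>v\<close> is a random element of \<open>S\<^sup>p\<real>\<^sup>2\<close>, on the probability space \<open>M\<close>, whose coordinates in some
  orthonormal basis are independent standard normal variables. (By rotation invariance the
  choice of the basis is immaterial.)
\<close>

definition bombieri_standard_gaussian :: "nat \<Rightarrow> 'a measure \<Rightarrow> ('a \<Rightarrow> poly2) \<Rightarrow> bool"
  where "bombieri_standard_gaussian p M v \<longleftrightarrow>
    prob_space M \<and>
    (\<forall>\<omega>\<in>space M. v \<omega> \<in> homogeneous_polys p) \<and>
    (\<exists>b. bombieri_orthonormal_basis p b \<and>
      prob_space.indep_vars M (\<lambda>_. borel) (\<lambda>i \<omega>. bombieri_inner p (v \<omega>) (b i)) {..p} \<and>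
      (\<forall>i\<le>p. distributed M lborel (\<lambda>\<omega>. bombieri_inner p (v \<omega>) (b i)) std_normal_density))"

definition signed_powers :: "nat \<Rightarrow> poly2 set"
  where "signed_powers p =
    {x. x \<noteq> 0 \<and> (\<exists>t\<^sub>1 t\<^sub>2. x = (const2 t\<^sub>1 * e\<^sub>1 + const2 t\<^sub>2 * e\<^sub>2) ^ p \<or>
                         x = - ((const2 t\<^sub>1 * e\<^sub>1 + const2 t\<^sub>2 * e\<^sub>2) ^ p))}"

text \<open>
  The tangent space of an embedded submanifold \<open>X\<close> at \<open>x\<close>, as the set of velocities at time \<open>0\<close>
  of smooth curves in \<open>X\<close> through \<open>x\<close>. Smoothness and velocity are taken coefficientwise.
\<close>

definition tangent_space :: "poly2 set \<Rightarrow> poly2 \<Rightarrow> poly2 set"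
  where "tangent_space X x =
    {w. \<exists>\<gamma> :: real \<Rightarrow> poly2. \<exists>\<epsilon>>0. \<gamma> 0 = x \<and>
      (\<forall>t\<in>{-\<epsilon><..<\<epsilon>}. \<gamma> t \<in> X \<and>
        (\<forall>\<alpha> n. ((deriv ^^ n) (\<lambda>s. Poly_Mapping.lookup (\<gamma> s) \<alpha>)) differentiable (at t))) \<and>
      (\<forall>\<alpha>. ((\<lambda>s. Poly_Mapping.lookup (\<gamma> s) \<alpha>) has_real_derivative
             Poly_Mapping.lookup w \<alpha>) (at 0))}"

text \<open>The critical points on \<open>X \<subseteq> S\<^sup>p\<real>\<^sup>2\<close> of the squared Bombieri distance to \<open>v\<close>.\<close>

definition critical_points :: "nat \<Rightarrow> poly2 set \<Rightarrow> poly2 \<Rightarrow> poly2 set"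
  where "critical_points p X v =
    {x \<in> X. \<forall>w \<in> tangent_space X x. bombieri_inner p (v - x) w = 0}"

text \<open>
  The number of critical points on the manifold of signed powers; it is \<open>\<infinity>\<close> when there are
  infinitely many of them, which does happen for exceptional \<open>v\<close>, e.g. for
  \<open>v = (e\<^sub>1\<^sup>2 + e\<^sub>2\<^sup>2) ^ m\<close> with \<open>p = 2 * m\<close>.
\<close>

definition num_critical_points :: "nat \<Rightarrow> poly2 \<Rightarrow> ennreal"
  where "num_critical_points p v =
    emeasure (count_space UNIV) (critical_points p (signed_powers p) v)"

end

theory Submission
  imports Defs "HOL-Real_Asymp.Real_Asymp"
begin

text \<open>
  Every point of the cone is \<open>s c\<^sup>p\<close> with \<open>s \<noteq> 0\<close> and \<open>c\<close> a unit vector of angle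
  \<open>\<theta> \<in> [0, \<pi>)\<close>. As \<open>\<langle>v, c\<^sup>p\<rangle>\<close> is the value \<open>F(\<theta>)\<close> of \<open>v\<close> at \<open>c\<close>, critical points correspond to the
  zeros of \<open>F'\<close> in \<open>[0, \<pi>)\<close> at which \<open>F\<close> does not vanish. For Gaussian \<open>v\<close> the process \<open>F\<close> is
  Gaussian with covariance \<open>cos\<^sup>p(\<theta> - \<phi>)\<close>, so that \<open>F\<close>, \<open>F'\<close>, \<open>F''\<close> have variances \<open>1\<close>, \<open>p\<close>,
  \<open>p (3p - 2)\<close>, and \<open>F'\<close> has on average \<open>\<surd>(3p - 2)\<close> zeros in \<open>[0, \<pi>)\<close>. The zeros are counted by the
  sign changes of \<open>F'\<close> on the grid \<open>k\<pi>/n\<close>: this number is at most the number of zeros and its lower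
  limit is the number of zeros once all zeros are simple, so Fatou's lemma gives the expectation.
\<close>

section \<open>Bivariate Gaussian laws\<close>

text \<open>Counting sign changes keeps the probability two-dimensional: only laws of pairs of
  linear combinations of the coordinates occur, and these depend on the Gram matrix alone; no
  density of \<open>F''\<close> conditioned on a zero of \<open>F'\<close> is needed. A short cell
  of length d has a sign change of \<open>F'\<close> with probability about d / pi times the ratio
  sqrt(3p - 2) of the standard deviations of \<open>F''\<close> and \<open>F'\<close>, and the cells
  have total length pi. Three exceptional events must be null: a common zero of \<open>F\<close> and
  \<open>F'\<close>, where the angle gives no point of the cone because 0 is removed; a double zero
  of \<open>F'\<close>; and a zero on the grid. The first two range over uncountably many angles. On
  the geometric side the tangent space is known only through curves, so its containment in the span
  of the radial and angular directions has to be extracted from an arbitrary curve.\<close>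

abbreviation gauss :: "real measure"
  where "gauss \<equiv> density lborel (\<lambda>x. ennreal (std_normal_density x))"

interpretation gauss: prob_space gauss
  by (rule prob_space_normal_density) simp

lemma emeasure_gauss_UNIV [simp]: "emeasure gauss UNIV = 1"
  using gauss.emeasure_space_1 by simp

text \<open>For c \<noteq> 0 two one-variable affine substitutions suffice: u = c x + s y at fixed
  y, after which c y - s x equals (y - s u) / c, and then one in the second variable. Their factors
  involving |c| cancel. For c = 0 the rotation only swaps the variables up to sign.\<close>

lemma nn_integral_lborel_rotate:
  fixes g :: "real \<times> real \<Rightarrow> ennreal"
  assumes [measurable]: "g \<in> borel_measurable borel" and cs: "c\<^sup>2 + s\<^sup>2 = 1"
  shows "(\<integral>\<^sup>+x. \<integral>\<^sup>+y. g (c * x + s * y, c * y - s * x) \<partial>lborel \<partial>lborel)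
    = (\<integral>\<^sup>+x. \<integral>\<^sup>+y. g (x, y) \<partial>lborel \<partial>lborel)"
proof (cases "c = 0")
  case True
  then have s: "s \<noteq> 0" "\<bar>s\<bar> = 1"
    using cs by (auto simp: power2_eq_1_iff)
  have scale: "(\<integral>\<^sup>+x. h (t * x) \<partial>lborel) = (\<integral>\<^sup>+x. h x \<partial>lborel)"
    if [measurable]: "h \<in> borel_measurable borel" and "\<bar>t\<bar> = 1" for h :: "real \<Rightarrow> ennreal" and t
    using that nn_integral_real_affine[of h t 0] by auto
  have "(\<integral>\<^sup>+x. \<integral>\<^sup>+y. g (c * x + s * y, c * y - s * x) \<partial>lborel \<partial>lborel)
      = (\<integral>\<^sup>+x. \<integral>\<^sup>+y. g (s * y, - s * x) \<partial>lborel \<partial>lborel)"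
    using True by simp
  also have "\<dots> = (\<integral>\<^sup>+x. \<integral>\<^sup>+y. g (y, - s * x) \<partial>lborel \<partial>lborel)"
    using s by (intro nn_integral_cong scale[of "\<lambda>y. g (y, - s * x)" s for x]) simp_all
  also have "\<dots> = (\<integral>\<^sup>+y. \<integral>\<^sup>+x. g (y, - s * x) \<partial>lborel \<partial>lborel)"
    by (rule lborel_pair.Fubini') measurable
  also have "\<dots> = (\<integral>\<^sup>+y. \<integral>\<^sup>+x. g (y, x) \<partial>lborel \<partial>lborel)"
    by (subst scale[of "\<lambda>x. g (y, x)" "- s" for y]) (use s in auto)
  finally show ?thesis .
next
  case False
  have c2: "s * s = 1 - c * c"
    using cs by (simp add: power2_eq_square)
  have eq: "(y - s * (c * x + s * y)) / c = c * y - s * x" for x y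
  proof -
    have "y - s * (c * x + s * y) = c * (c * y - s * x)"
      using c2 by algebra
    then show ?thesis
      using False by simp
  qed
  have "\<bar>c\<bar> * (\<integral>\<^sup>+x. \<integral>\<^sup>+y. g (c * x + s * y, c * y - s * x) \<partial>lborel \<partial>lborel)
      = \<bar>c\<bar> * (\<integral>\<^sup>+y. \<integral>\<^sup>+x. g (c * x + s * y, c * y - s * x) \<partial>lborel \<partial>lborel)"
    by (subst lborel_pair.Fubini') auto
  also have "\<dots> = (\<integral>\<^sup>+y. \<bar>c\<bar> * (\<integral>\<^sup>+x. g (c * x + s * y, c * y - s * x) \<partial>lborel) \<partial>lborel)"
    by (rule nn_integral_cmult[symmetric]) measurable
  also have "\<dots> = (\<integral>\<^sup>+y. \<integral>\<^sup>+x. g (x, (y - s * x) / c) \<partial>lborel \<partial>lborel)"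
  proof (rule nn_integral_cong)
    fix y
    show "\<bar>c\<bar> * (\<integral>\<^sup>+x. g (c * x + s * y, c * y - s * x) \<partial>lborel) = (\<integral>\<^sup>+x. g (x, (y - s * x) / c) \<partial>lborel)"
      using False nn_integral_real_affine[of "\<lambda>x. g (x, (y - s * x) / c)" c "s * y"]
      by (simp add: eq add.commute)
  qed
  also have "\<dots> = (\<integral>\<^sup>+x. \<integral>\<^sup>+y. g (x, (y - s * x) / c) \<partial>lborel \<partial>lborel)"
    by (rule lborel_pair.Fubini') measurable
  also have "\<dots> = (\<integral>\<^sup>+x. \<bar>c\<bar> * (\<integral>\<^sup>+y. g (x, y) \<partial>lborel) \<partial>lborel)"
  proof (rule nn_integral_cong)
    fix x
    show "(\<integral>\<^sup>+y. g (x, (y - s * x) / c) \<partial>lborel) = \<bar>c\<bar> * (\<integral>\<^sup>+y. g (x, y) \<partial>lborel)"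
      using False nn_integral_real_affine[of "\<lambda>y. g (x, (y - s * x) / c)" c "s * x"] by simp
  qed
  also have "\<dots> = \<bar>c\<bar> * (\<integral>\<^sup>+x. \<integral>\<^sup>+y. g (x, y) \<partial>lborel \<partial>lborel)"
    by (rule nn_integral_cmult) measurable
  finally show ?thesis
    using False by (simp add: ennreal_mult_cancel_left)
qed

text \<open>The Gaussian density in the plane depends on x^2 + y^2 only; moving it into the
  integrand \<open>w\<close> leaves the rotation invariance of Lebesgue measure.\<close>

lemma nn_integral_gauss_rotate:
  fixes f :: "real \<times> real \<Rightarrow> ennreal"
  assumes [measurable]: "f \<in> borel_measurable borel" and cs: "c\<^sup>2 + s\<^sup>2 = 1"
  shows "(\<integral>\<^sup>+x. \<integral>\<^sup>+y. f (c * x + s * y, c * y - s * x) \<partial>gauss \<partial>gauss)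
    = (\<integral>\<^sup>+x. \<integral>\<^sup>+y. f (x, y) \<partial>gauss \<partial>gauss)"
proof -
  define w where "w = (\<lambda>z. ennreal (exp (- (fst z)\<^sup>2 / 2 - (snd z)\<^sup>2 / 2) / (2 * pi)) * f z)"
  have [measurable]: "f \<in> borel_measurable (borel \<Otimes>\<^sub>M borel)"
    by (simp add: borel_prod)
  have "w \<in> borel_measurable (borel \<Otimes>\<^sub>M borel)"
    unfolding w_def by measurable
  then have [measurable]: "w \<in> borel_measurable borel"
    by (simp add: borel_prod)
  have expand: "(\<integral>\<^sup>+x. \<integral>\<^sup>+y. h x y \<partial>gauss \<partial>gauss) =
      (\<integral>\<^sup>+x. \<integral>\<^sup>+y. ennreal (exp (- x\<^sup>2 / 2 - y\<^sup>2 / 2) / (2 * pi)) * h x y \<partial>lborel \<partial>lborel)"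
    if [measurable]: "case_prod h \<in> borel_measurable (borel \<Otimes>\<^sub>M borel)" for h :: "real \<Rightarrow> real \<Rightarrow> ennreal"
  proof -
    have "std_normal_density x * std_normal_density y = exp (- x\<^sup>2 / 2 - y\<^sup>2 / 2) / (2 * pi)" for x y
      by (simp add: std_normal_density_def exp_diff exp_minus field_simps flip: exp_add)
    then have dens: "ennreal (std_normal_density x) * (ennreal (std_normal_density y) * z)
        = ennreal (exp (- x\<^sup>2 / 2 - y\<^sup>2 / 2) / (2 * pi)) * z" for x y z
      by (metis ennreal_mult mult.assoc normal_density_nonneg)
    show ?thesis
      by (simp add: nn_integral_density nn_integral_cmult[symmetric] dens)
  qed
  have sq: "(c * x + s * y)\<^sup>2 + (c * y - s * x)\<^sup>2 = x\<^sup>2 + y\<^sup>2" for x y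
    using cs by algebra
  have "- (c * x + s * y)\<^sup>2 / 2 - (c * y - s * x)\<^sup>2 / 2 = - x\<^sup>2 / 2 - y\<^sup>2 / 2" for x y
    using sq[of x y] by argo
  then have "(\<integral>\<^sup>+x. \<integral>\<^sup>+y. f (c * x + s * y, c * y - s * x) \<partial>gauss \<partial>gauss)
      = (\<integral>\<^sup>+x. \<integral>\<^sup>+y. w (c * x + s * y, c * y - s * x) \<partial>lborel \<partial>lborel)"
    by (subst expand) (auto simp: w_def)
  also have "\<dots> = (\<integral>\<^sup>+x. \<integral>\<^sup>+y. w (x, y) \<partial>lborel \<partial>lborel)"
    by (rule nn_integral_lborel_rotate) (use cs in auto)
  also have "\<dots> = (\<integral>\<^sup>+x. \<integral>\<^sup>+y. f (x, y) \<partial>gauss \<partial>gauss)"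
    by (subst expand) (auto simp: w_def)
  finally show ?thesis .
qed

text \<open>(c, s) is the direction of (r, a), and r s = a c says that nothing is left off the axis
  after the rotation. For the zero vector any direction does.\<close>

lemma rotate_to_axis:
  obtains c s :: real where "c\<^sup>2 + s\<^sup>2 = 1" "r * c + a * s = sqrt (r\<^sup>2 + a\<^sup>2)" "r * s = a * c"
proof (cases "r = 0 \<and> a = 0")
  case True
  then show ?thesis
    using that[of 1 0] by simp
next
  case False
  define R where "R = sqrt (r\<^sup>2 + a\<^sup>2)"
  have R: "R \<noteq> 0" "R\<^sup>2 = r\<^sup>2 + a\<^sup>2"
    using False by (auto simp: R_def sum_power2_eq_zero_iff)
  have "(r / R)\<^sup>2 + (a / R)\<^sup>2 = 1"
    using R False by (simp add: power_divide flip: add_divide_distrib)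
  moreover have "r * (r / R) + a * (a / R) = R"
    using R by (simp add: power2_eq_square flip: add_divide_distrib) (simp add: field_simps)
  ultimately show ?thesis
    using that[of "r / R" "a / R"] False by (simp add: R_def)
qed

text \<open>
  Each new variable is absorbed into the lower triangular (Cholesky) form by two plane rotations.
\<close>

lemma PiM_gauss_cholesky:
  fixes a b :: "'i \<Rightarrow> real"
  assumes "finite I"
  shows "\<exists>r q t. 0 \<le> r \<and> r\<^sup>2 = (\<Sum>i\<in>I. (a i)\<^sup>2) \<and> r * q = (\<Sum>i\<in>I. a i * b i)
    \<and> q\<^sup>2 + t\<^sup>2 = (\<Sum>i\<in>I. (b i)\<^sup>2)
    \<and> (\<forall>f\<in>borel_measurable borel. (\<integral>\<^sup>+z. f (\<Sum>i\<in>I. a i * z i, \<Sum>i\<in>I. b i * z i) \<partial>(\<Pi>\<^sub>M i\<in>I. gauss))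
        = (\<integral>\<^sup>+x. \<integral>\<^sup>+y. f (r * x, q * x + t * y) \<partial>gauss \<partial>gauss))"
  using assms
proof (induction I rule: finite_induct)
  case empty
  then show ?case
    by (intro exI[of _ 0]) (auto simp: PiM_empty)
next
  case (insert i I)
  then obtain r q t where r: "0 \<le> r" "r\<^sup>2 = (\<Sum>i\<in>I. (a i)\<^sup>2)" "r * q = (\<Sum>i\<in>I. a i * b i)"
    "q\<^sup>2 + t\<^sup>2 = (\<Sum>i\<in>I. (b i)\<^sup>2)"
    and IH: "\<And>f. f \<in> borel_measurable borel \<Longrightarrow>
      (\<integral>\<^sup>+z. f (\<Sum>i\<in>I. a i * z i, \<Sum>i\<in>I. b i * z i) \<partial>(\<Pi>\<^sub>M i\<in>I. gauss))
        = (\<integral>\<^sup>+x. \<integral>\<^sup>+y. f (r * x, q * x + t * y) \<partial>gauss \<partial>gauss)"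
    by blast
  interpret P: product_sigma_finite "\<lambda>_::'i. gauss"
    by standard
  interpret G: pair_sigma_finite gauss gauss
    by standard
  obtain c s where cs: "c\<^sup>2 + s\<^sup>2 = 1" "r * c + a i * s = sqrt (r\<^sup>2 + (a i)\<^sup>2)" "r * s = a i * c"
    using rotate_to_axis .
  \<comment> \<open>Rotating the coefficients \<open>(r, a i)\<close> onto the axis gives
    \<open>(R, 0)\<close> and turns \<open>(q, b i)\<close> into \<open>(Q, K)\<close>. The residual
    \<open>K\<close> sits on the new variable and is merged with \<open>t\<close> into
    \<open>T\<close> by the second rotation.\<close>
  define R Q K where "R = sqrt (r\<^sup>2 + (a i)\<^sup>2)" and "Q = q * c + b i * s" and "K = b i * c - q * s"
  obtain c' s' where cs': "c'\<^sup>2 + s'\<^sup>2 = 1" "t * c' + K * s' = sqrt (t\<^sup>2 + K\<^sup>2)" "t * s' = K * c'"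
    using rotate_to_axis .
  define T where "T = sqrt (t\<^sup>2 + K\<^sup>2)"
  have "R\<^sup>2 = r\<^sup>2 + (a i)\<^sup>2"
    by (simp add: R_def)
  then have 1: "R\<^sup>2 = (\<Sum>i\<in>insert i I. (a i)\<^sup>2)"
    using insert r by simp
  have "R * Q = r * q + a i * b i"
    unfolding R_def Q_def cs(2)[symmetric] using cs(1,3) by algebra
  then have 2: "R * Q = (\<Sum>i\<in>insert i I. a i * b i)"
    using insert r by simp
  have "Q\<^sup>2 + K\<^sup>2 = q\<^sup>2 + (b i)\<^sup>2"
    unfolding Q_def K_def using cs(1) by algebra
  moreover have "T\<^sup>2 = t\<^sup>2 + K\<^sup>2"
    by (simp add: T_def)
  ultimately have 3: "Q\<^sup>2 + T\<^sup>2 = (\<Sum>i\<in>insert i I. (b i)\<^sup>2)"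
    using insert r by simp
  have "(\<integral>\<^sup>+z. f (\<Sum>i\<in>insert i I. a i * z i, \<Sum>i\<in>insert i I. b i * z i) \<partial>(\<Pi>\<^sub>M i\<in>insert i I. gauss))
      = (\<integral>\<^sup>+x. \<integral>\<^sup>+y. f (R * x, Q * x + T * y) \<partial>gauss \<partial>gauss)"
    if f: "f \<in> borel_measurable borel" for f
  proof -
    note [measurable] = f
    have [measurable]: "f \<in> borel_measurable (borel \<Otimes>\<^sub>M borel)"
      by (simp add: borel_prod)
    have "(\<integral>\<^sup>+z. f (\<Sum>i\<in>insert i I. a i * z i, \<Sum>i\<in>insert i I. b i * z i) \<partial>(\<Pi>\<^sub>M i\<in>insert i I. gauss))
        = (\<integral>\<^sup>+u. \<integral>\<^sup>+z. f (\<Sum>j\<in>insert i I. a j * (z(i := u)) j, \<Sum>j\<in>insert i I. b j * (z(i := u)) j)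
            \<partial>(\<Pi>\<^sub>M i\<in>I. gauss) \<partial>gauss)"
      by (rule P.product_nn_integral_insert_rev) (use insert in auto)
    also have "\<dots> = (\<integral>\<^sup>+u. \<integral>\<^sup>+z. f (a i * u + (\<Sum>j\<in>I. a j * z j), b i * u + (\<Sum>j\<in>I. b j * z j))
            \<partial>(\<Pi>\<^sub>M i\<in>I. gauss) \<partial>gauss)"
    proof -
      have "(\<Sum>j\<in>I. e j * (z(i := u)) j) = (\<Sum>j\<in>I. e j * z j)" for e z :: "'i \<Rightarrow> real" and u
        using insert by (intro sum.cong) auto
      then show ?thesis
        using insert by simp
    qed
    also have "\<dots> = (\<integral>\<^sup>+u. \<integral>\<^sup>+x. \<integral>\<^sup>+y. f (a i * u + r * x, b i * u + (q * x + t * y)) \<partial>gauss \<partial>gauss \<partial>gauss)"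
    proof (rule nn_integral_cong)
      fix u
      have "(\<lambda>w. f (a i * u + fst w, b i * u + snd w)) \<in> borel_measurable (borel \<Otimes>\<^sub>M borel)"
        by measurable
      then show "(\<integral>\<^sup>+z. f (a i * u + (\<Sum>j\<in>I. a j * z j), b i * u + (\<Sum>j\<in>I. b j * z j)) \<partial>(\<Pi>\<^sub>M i\<in>I. gauss))
        = (\<integral>\<^sup>+x. \<integral>\<^sup>+y. f (a i * u + r * x, b i * u + (q * x + t * y)) \<partial>gauss \<partial>gauss)"
        using IH[of "\<lambda>w. f (a i * u + fst w, b i * u + snd w)"] by (simp add: borel_prod)
    qed
    also have "\<dots> = (\<integral>\<^sup>+x. \<integral>\<^sup>+u. \<integral>\<^sup>+y. f (a i * u + r * x, b i * u + (q * x + t * y)) \<partial>gauss \<partial>gauss \<partial>gauss)"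
      by (rule G.Fubini') measurable
    also have "\<dots> = (\<integral>\<^sup>+x. \<integral>\<^sup>+u. \<integral>\<^sup>+y. f (R * x, Q * x + (t * y + K * u)) \<partial>gauss \<partial>gauss \<partial>gauss)"
    proof -
      define h where "h = (\<lambda>(x, u). \<integral>\<^sup>+y. f (a i * u + r * x, b i * u + (q * x + t * y)) \<partial>gauss)"
      have "h \<in> borel_measurable (borel \<Otimes>\<^sub>M borel)"
        unfolding h_def by measurable
      then have "(\<integral>\<^sup>+x. \<integral>\<^sup>+u. h (c * x + (- s) * u, c * u - (- s) * x) \<partial>gauss \<partial>gauss)
          = (\<integral>\<^sup>+x. \<integral>\<^sup>+u. h (x, u) \<partial>gauss \<partial>gauss)"
        using cs(1) by (intro nn_integral_gauss_rotate) (auto simp: borel_prod)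
      moreover have "a i * (c * u - (- s) * x) + r * (c * x + (- s) * u) = R * x" for x u
        unfolding R_def cs(2)[symmetric] using cs(3) by algebra
      moreover have "b i * (c * u - (- s) * x) + (q * (c * x + (- s) * u) + t * y) = Q * x + (t * y + K * u)" for x u y
        unfolding Q_def K_def by algebra
      ultimately show ?thesis
        by (simp only: h_def prod.case)
    qed
    also have "\<dots> = (\<integral>\<^sup>+x. \<integral>\<^sup>+y. \<integral>\<^sup>+u. f (R * x, Q * x + (t * y + K * u)) \<partial>gauss \<partial>gauss \<partial>gauss)"
      by (intro nn_integral_cong G.Fubini') measurable
    also have "\<dots> = (\<integral>\<^sup>+x. \<integral>\<^sup>+y. \<integral>\<^sup>+u. f (R * x, Q * x + T * y) \<partial>gauss \<partial>gauss \<partial>gauss)"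
    proof (rule nn_integral_cong)
      fix x
      define h where "h = (\<lambda>(y, u). f (R * x, Q * x + (t * y + K * u)))"
      have "h \<in> borel_measurable (borel \<Otimes>\<^sub>M borel)"
        unfolding h_def by measurable
      then have "(\<integral>\<^sup>+y. \<integral>\<^sup>+u. h (c' * y + (- s') * u, c' * u - (- s') * y) \<partial>gauss \<partial>gauss)
          = (\<integral>\<^sup>+y. \<integral>\<^sup>+u. h (y, u) \<partial>gauss \<partial>gauss)"
        using cs'(1) by (intro nn_integral_gauss_rotate) (auto simp: borel_prod)
      moreover have "t * (c' * y + (- s') * u) + K * (c' * u - (- s') * y) = T * y" for y u
        unfolding T_def cs'(2)[symmetric] using cs'(3) by algebra
      ultimately show "(\<integral>\<^sup>+y. \<integral>\<^sup>+u. f (R * x, Q * x + (t * y + K * u)) \<partial>gauss \<partial>gauss)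
          = (\<integral>\<^sup>+y. \<integral>\<^sup>+u. f (R * x, Q * x + T * y) \<partial>gauss \<partial>gauss)"
        by (simp add: h_def)
    qed
    finally show ?thesis
      by simp
  qed
  moreover have "0 \<le> R"
    by (simp add: R_def)
  ultimately show ?case
    using 1 2 3 by blast
qed

section \<open>Linear combinations of independent standard normals\<close>

locale standard_normals = prob_space M
  for M :: "'a measure" and I :: "'i set" and X :: "'i \<Rightarrow> 'a \<Rightarrow> real" +
  assumes finite_index: "finite I" and nonempty_index: "I \<noteq> {}"
    and indep: "indep_vars (\<lambda>_. borel) X I"
    and std_normal: "\<And>i. i \<in> I \<Longrightarrow> distributed M lborel (X i) std_normal_density"
begin

lemma measurable_X [measurable]: "i \<in> I \<Longrightarrow> X i \<in> borel_measurable M"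
  using std_normal[of i] by (simp add: distributed_def)

lemma measurable_combination: "(\<lambda>\<omega>. \<Sum>i\<in>I. X i \<omega> * a i) \<in> borel_measurable M"
  by (intro borel_measurable_sum borel_measurable_times measurable_X) auto

lemma distr_eq_PiM: "distr M (\<Pi>\<^sub>M i\<in>I. borel) (\<lambda>\<omega>. \<lambda>i\<in>I. X i \<omega>) = (\<Pi>\<^sub>M i\<in>I. gauss)"
proof -
  have "distr M borel (X i) = gauss" if "i \<in> I" for i
    using distributed_distr_eq_density[OF std_normal[OF that]] by (simp cong: distr_cong)
  then have "(\<Pi>\<^sub>M i\<in>I. distr M borel (X i)) = (\<Pi>\<^sub>M i\<in>I. gauss)"
    by (intro PiM_cong) auto
  then show ?thesis
    using indep_vars_iff_distr_eq_PiM'[of I X "\<lambda>_. borel"] nonempty_index indep measurable_X by auto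
qed

text \<open>\<open>(r, 0)\<close> and \<open>(q, t)\<close> are the rows of a Cholesky factor of the
  Gram matrix of \<open>a\<close> and \<open>b\<close>. The off-diagonal entry is described by the
  product \<open>r * q\<close> instead of a quotient, so that \<open>r = 0\<close> is
  covered.\<close>

lemma emeasure_pair:
  fixes a b :: "'i \<Rightarrow> real"
  obtains r q t where "0 \<le> r" "r\<^sup>2 = (\<Sum>i\<in>I. (a i)\<^sup>2)" "r * q = (\<Sum>i\<in>I. a i * b i)"
    "q\<^sup>2 + t\<^sup>2 = (\<Sum>i\<in>I. (b i)\<^sup>2)"
    "\<And>S. S \<in> sets borel \<Longrightarrow>
      emeasure M {\<omega>\<in>space M. (\<Sum>i\<in>I. X i \<omega> * a i, \<Sum>i\<in>I. X i \<omega> * b i) \<in> S}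
      = (\<integral>\<^sup>+x. \<integral>\<^sup>+y. indicator S (r * x, q * x + t * y) \<partial>gauss \<partial>gauss)"
proof -
  obtain r q t where rqt: "0 \<le> r" "r\<^sup>2 = (\<Sum>i\<in>I. (a i)\<^sup>2)" "r * q = (\<Sum>i\<in>I. a i * b i)"
    "q\<^sup>2 + t\<^sup>2 = (\<Sum>i\<in>I. (b i)\<^sup>2)"
    and law: "\<And>f. f \<in> borel_measurable borel \<Longrightarrow>
      (\<integral>\<^sup>+z. f (\<Sum>i\<in>I. a i * z i, \<Sum>i\<in>I. b i * z i) \<partial>(\<Pi>\<^sub>M i\<in>I. gauss))
        = (\<integral>\<^sup>+x. \<integral>\<^sup>+y. f (r * x, q * x + t * y) \<partial>gauss \<partial>gauss)"
    using PiM_gauss_cholesky[OF finite_index, of a b] by blast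
  have "emeasure M {\<omega>\<in>space M. (\<Sum>i\<in>I. X i \<omega> * a i, \<Sum>i\<in>I. X i \<omega> * b i) \<in> S}
      = (\<integral>\<^sup>+x. \<integral>\<^sup>+y. indicator S (r * x, q * x + t * y) \<partial>gauss \<partial>gauss)"
    if S[measurable]: "S \<in> sets borel" for S
  proof -
    have [measurable]: "(\<lambda>\<omega>. (\<Sum>i\<in>I. X i \<omega> * a i, \<Sum>i\<in>I. X i \<omega> * b i)) \<in> measurable M borel"
      using measurable_combination by (simp add: borel_prod[symmetric])
    have [measurable]: "(\<lambda>\<omega>. \<lambda>i\<in>I. X i \<omega>) \<in> measurable M (\<Pi>\<^sub>M i\<in>I. borel)"
      by (intro measurable_restrict measurable_X)
    have [measurable]: "(\<lambda>z. (\<Sum>i\<in>I. a i * z i, \<Sum>i\<in>I. b i * z i)) \<in> measurable (\<Pi>\<^sub>M i\<in>I. borel) borel"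
      unfolding borel_prod[symmetric] by measurable
    have "emeasure M {\<omega>\<in>space M. (\<Sum>i\<in>I. X i \<omega> * a i, \<Sum>i\<in>I. X i \<omega> * b i) \<in> S}
        = (\<integral>\<^sup>+\<omega>. indicator {\<omega>\<in>space M. (\<Sum>i\<in>I. X i \<omega> * a i, \<Sum>i\<in>I. X i \<omega> * b i) \<in> S} \<omega> \<partial>M)"
      by (rule nn_integral_indicator[symmetric]) measurable
    also have "\<dots> = (\<integral>\<^sup>+\<omega>. indicator S (\<Sum>i\<in>I. a i * (\<lambda>i\<in>I. X i \<omega>) i, \<Sum>i\<in>I. b i * (\<lambda>i\<in>I. X i \<omega>) i) \<partial>M)"
      by (intro nn_integral_cong) (auto simp: indicator_def mult.commute)
    also have "\<dots> = (\<integral>\<^sup>+z. indicator S (\<Sum>i\<in>I. a i * z i, \<Sum>i\<in>I. b i * z i) \<partial>(\<Pi>\<^sub>M i\<in>I. gauss))"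
      unfolding distr_eq_PiM[symmetric] by (rule nn_integral_distr[symmetric]) measurable
    also have "\<dots> = (\<integral>\<^sup>+x. \<integral>\<^sup>+y. indicator S (r * x, q * x + t * y) \<partial>gauss \<partial>gauss)"
      by (rule law) simp
    finally show ?thesis .
  qed
  with rqt show ?thesis
    by (rule that)
qed

end

section \<open>Probability of opposite signs for a Gaussian pair\<close>

text \<open>Length times the largest or smallest value of the density on the interval: the density
  decreases in |x|, so its extremes are at 0 and at z. Writing the ends with \<open>min\<close> and
  \<open>max\<close> treats both signs of z together.\<close>

lemma emeasure_gauss_interval:
  fixes z :: real
  assumes "{min 0 z<..<max 0 z} \<subseteq> S" "S \<subseteq> {min 0 z..max 0 z}" "S \<in> sets borel"
  shows "emeasure gauss S \<le> ennreal (\<bar>z\<bar> / sqrt (2 * pi))"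
    and "emeasure gauss S \<ge> ennreal (\<bar>z\<bar> * std_normal_density z)"
proof -
  have len: "max 0 z - min 0 z = \<bar>z\<bar>"
    by (simp add: max_def min_def)
  have S: "emeasure lborel S = ennreal \<bar>z\<bar>"
  proof (rule antisym)
    show "emeasure lborel S \<le> ennreal \<bar>z\<bar>"
      using emeasure_mono[OF assms(2), of lborel] len by simp
    show "ennreal \<bar>z\<bar> \<le> emeasure lborel S"
      using emeasure_mono[OF assms(1), of lborel] assms(3) len by simp
  qed
  have "emeasure gauss S = (\<integral>\<^sup>+x. ennreal (std_normal_density x) * indicator S x \<partial>lborel)"
    using assms(3) by (simp add: emeasure_density)
  also have "\<dots> \<le> (\<integral>\<^sup>+x. ennreal (1 / sqrt (2 * pi)) * indicator S x \<partial>lborel)"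
    by (intro nn_integral_mono mult_right_mono ennreal_leI) (auto simp: std_normal_density_def divide_simps)
  also have "\<dots> = ennreal (\<bar>z\<bar> / sqrt (2 * pi))"
    using assms(3) S by (simp add: nn_integral_cmult_indicator flip: ennreal_mult)
  finally show "emeasure gauss S \<le> ennreal (\<bar>z\<bar> / sqrt (2 * pi))" .
  have "ennreal (\<bar>z\<bar> * std_normal_density z) = (\<integral>\<^sup>+x. ennreal (std_normal_density z) * indicator S x \<partial>lborel)"
    using assms(3) S by (subst nn_integral_cmult_indicator) (simp_all add: mult.commute flip: ennreal_mult)
  also have "\<dots> \<le> (\<integral>\<^sup>+x. ennreal (std_normal_density x) * indicator S x \<partial>lborel)"
  proof (intro nn_integral_mono)
    fix x
    show "ennreal (std_normal_density z) * indicator S x \<le> ennreal (std_normal_density x) * indicator S x"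
    proof (cases "x \<in> S")
      case True
      then have "\<bar>x\<bar> \<le> \<bar>z\<bar>"
        using assms(2) by (auto simp: min_def max_def split: if_splits)
      then have "x\<^sup>2 \<le> z\<^sup>2"
        by (simp add: abs_le_square_iff)
      then show ?thesis
        using True by (auto simp: std_normal_density_def intro!: ennreal_leI divide_right_mono mult_left_mono)
    qed simp
  qed
  also have "\<dots> = emeasure gauss S"
    using assms(3) by (simp add: emeasure_density)
  finally show "emeasure gauss S \<ge> ennreal (\<bar>z\<bar> * std_normal_density z)" .
qed

lemma nn_integral_normal_abs:
  assumes "0 < \<sigma>"
  shows "(\<integral>\<^sup>+x. ennreal (normal_density 0 \<sigma> x * \<bar>x\<bar>) \<partial>lborel) = ennreal (\<sigma> * sqrt (2 / pi))"
  using normal_moment_abs_odd[OF assms, of 0 0]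
  by (intro nn_integral_eq_integral[THEN trans])
     (auto simp: has_bochner_integral_iff intro!: mult_nonneg_nonneg)

text \<open>
  With \<open>\<tau> = \<bar>t\<bar> / q\<close>, the probability that \<open>x\<close> and \<open>q x + t y\<close> have opposite signs is exactly
  \<open>arctan \<tau> / \<pi>\<close>; the two bounds below are elementary and agree to first order in \<open>\<tau>\<close>.
\<close>

lemma gauss_wedge:
  fixes r q t :: real
  assumes r: "0 < r" and q: "0 < q"
  defines "\<tau> \<equiv> \<bar>t\<bar> / q"
  defines "P \<equiv> (\<integral>\<^sup>+x. \<integral>\<^sup>+y. indicator {z. fst z * snd z < 0} (r * x, q * x + t * y) \<partial>gauss \<partial>gauss)"
  shows "P \<le> ennreal (\<tau> / pi)" and "P \<ge> ennreal (\<tau> / (pi * (1 + \<tau>\<^sup>2)))"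
proof -
  interpret G: pair_sigma_finite gauss gauss
    by standard
  define S where "S = (\<lambda>y. {x. r * x * (q * x + t * y) < 0})"
  have S[measurable]: "S y \<in> sets borel" for y
    unfolding S_def by measurable
  \<comment> \<open>At fixed y the wedge is the interval between 0 and -t y / q, of length \<tau>
    |y|; hence x is made the inner variable below.\<close>
  have sub: "{min 0 (- t * y / q)<..<max 0 (- t * y / q)} \<subseteq> S y"
       "S y \<subseteq> {min 0 (- t * y / q)..max 0 (- t * y / q)}" for y
  proof -
    have "x \<in> S y \<longleftrightarrow> x * (x - (- t * y / q)) < 0" for x
    proof -
      have "r * x * (q * x + t * y) = (r * q) * (x * (x - (- t * y / q)))"
        using q by (simp add: field_simps)
      moreover have "(r * q) * w < 0 \<longleftrightarrow> w < 0" for w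
        using r q mult_less_cancel_left_pos[of "r * q" w 0] by simp
      ultimately show ?thesis
        unfolding S_def mem_Collect_eq by (simp only:)
    qed
    moreover have "w * (w - d) < 0 \<longleftrightarrow> w \<in> {min 0 d<..<max 0 d}" for w d :: real
      by (cases "0 \<le> d") (auto simp: mult_less_0_iff)
    ultimately have "S y = {min 0 (- t * y / q)<..<max 0 (- t * y / q)}"
      by blast
    then show "{min 0 (- t * y / q)<..<max 0 (- t * y / q)} \<subseteq> S y"
       "S y \<subseteq> {min 0 (- t * y / q)..max 0 (- t * y / q)}"
      by (simp_all add: greaterThanLessThan_subseteq_atLeastAtMost_iff del: min_less_iff_disj)
  qed
  have abs: "\<bar>- t * y / q\<bar> = \<tau> * \<bar>y\<bar>" for y
    using q by (simp add: \<tau>_def abs_mult)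
  have \<tau>: "0 \<le> \<tau>"
    using q by (simp add: \<tau>_def)
  have "{z \<in> space (borel \<Otimes>\<^sub>M borel). fst z * snd z < (0::real)} \<in> sets (borel \<Otimes>\<^sub>M borel)"
    by measurable
  then have [measurable]: "{z :: real \<times> real. fst z * snd z < 0} \<in> sets (borel \<Otimes>\<^sub>M borel)"
    by (simp add: space_pair_measure)
  have "P = (\<integral>\<^sup>+y. \<integral>\<^sup>+x. indicator {z. fst z * snd z < 0} (r * x, q * x + t * y) \<partial>gauss \<partial>gauss)"
    unfolding P_def by (rule G.Fubini') measurable
  also have "\<dots> = (\<integral>\<^sup>+y. \<integral>\<^sup>+x. indicator (S y) x \<partial>gauss \<partial>gauss)"
    by (intro nn_integral_cong) (auto simp: S_def indicator_def)
  also have "\<dots> = (\<integral>\<^sup>+y. emeasure gauss (S y) \<partial>gauss)"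
    by simp
  finally have P: "P = (\<integral>\<^sup>+y. emeasure gauss (S y) \<partial>gauss)" .
  have "P \<le> (\<integral>\<^sup>+y. ennreal (\<tau> * \<bar>y\<bar> / sqrt (2 * pi)) \<partial>gauss)"
    unfolding P using emeasure_gauss_interval(1)[OF sub S] by (intro nn_integral_mono) (simp only: abs)
  also have "\<dots> = (\<integral>\<^sup>+y. ennreal (\<tau> / sqrt (2 * pi)) * ennreal (std_normal_density y * \<bar>y\<bar>) \<partial>lborel)"
    using \<tau> by (subst nn_integral_density) (auto intro!: nn_integral_cong simp: ac_simps simp flip: ennreal_mult)
  also have "\<dots> = ennreal (\<tau> / sqrt (2 * pi)) * ennreal (sqrt (2 / pi))"
    by (subst nn_integral_cmult) (use nn_integral_normal_abs[of 1] in auto)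
  also have "\<dots> = ennreal (\<tau> / pi)"
    using \<tau> by (simp add: real_sqrt_mult real_sqrt_divide flip: ennreal_mult)
  finally show "P \<le> ennreal (\<tau> / pi)" .
  \<comment> \<open>The lower bound weighs |y| by the product of the densities at y and at \<tau> y.
    Up to the factor \<sigma> / sqrt(2 pi) this is a centred normal density of variance 1 / (1 +
    \<tau>^2), whose first absolute moment is \<sigma> sqrt(2 / pi).\<close>
  define \<sigma> where "\<sigma> = 1 / sqrt (1 + \<tau>\<^sup>2)"
  have s1: "0 < 1 + \<tau>\<^sup>2"
    by (simp add: add_pos_nonneg)
  then have \<sigma>: "0 < \<sigma>" "\<sigma>\<^sup>2 = 1 / (1 + \<tau>\<^sup>2)"
    by (auto simp: \<sigma>_def power_divide)
  have dens: "std_normal_density y * std_normal_density (\<tau> * y) = \<sigma> / sqrt (2 * pi) * normal_density 0 \<sigma> y" for y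
  proof -
    have "- y\<^sup>2 / 2 + - (\<tau> * y)\<^sup>2 / 2 = - (y - 0)\<^sup>2 / (2 * \<sigma>\<^sup>2)"
      unfolding \<sigma>(2) using s1 by (simp add: field_simps)
    moreover have "sqrt (2 * pi * \<sigma>\<^sup>2) = \<sigma> * sqrt (2 * pi)"
      using \<sigma>(1) by (simp add: real_sqrt_mult)
    moreover have "std_normal_density y * std_normal_density (\<tau> * y)
        = 1 / sqrt (2 * pi) * (1 / sqrt (2 * pi)) * exp (- y\<^sup>2 / 2 + - (\<tau> * y)\<^sup>2 / 2)"
      unfolding std_normal_density_def by (subst exp_add) (simp only: ac_simps)
    ultimately show ?thesis
      using \<sigma>(1) unfolding normal_density_def by simp
  qed
  have "ennreal (\<tau> / (pi * (1 + \<tau>\<^sup>2))) = ennreal (\<tau> * \<sigma> / sqrt (2 * pi)) * ennreal (\<sigma> * sqrt (2 / pi))"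
  proof -
    have "sqrt (2 / pi) / sqrt (2 * pi) = 1 / pi"
      by (simp add: real_sqrt_mult real_sqrt_divide)
    then have "\<tau> * \<sigma> / sqrt (2 * pi) * (\<sigma> * sqrt (2 / pi)) = \<tau> * \<sigma>\<^sup>2 * (1 / pi)"
      by (metis (no_types, lifting) mult.assoc mult.commute power2_eq_square times_divide_eq_left times_divide_eq_right)
    then show ?thesis
      using \<tau> \<sigma> by (simp add: mult.commute flip: ennreal_mult)
  qed
  also have "\<dots> = (\<integral>\<^sup>+y. ennreal (\<tau> * \<sigma> / sqrt (2 * pi)) * ennreal (normal_density 0 \<sigma> y * \<bar>y\<bar>) \<partial>lborel)"
    by (subst nn_integral_cmult) (use nn_integral_normal_abs[OF \<sigma>(1)] in auto)
  also have "\<dots> = (\<integral>\<^sup>+y. ennreal (std_normal_density y) * ennreal (\<tau> * \<bar>y\<bar> * std_normal_density (\<tau> * y)) \<partial>lborel)"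
  proof (rule nn_integral_cong)
    fix y
    have "\<tau> * \<sigma> / sqrt (2 * pi) * (normal_density 0 \<sigma> y * \<bar>y\<bar>)
        = std_normal_density y * (\<tau> * \<bar>y\<bar> * std_normal_density (\<tau> * y))"
      using arg_cong[OF dens[of y], of "\<lambda>w. \<tau> * \<bar>y\<bar> * w"] by (simp add: ac_simps)
    then show "ennreal (\<tau> * \<sigma> / sqrt (2 * pi)) * ennreal (normal_density 0 \<sigma> y * \<bar>y\<bar>)
        = ennreal (std_normal_density y) * ennreal (\<tau> * \<bar>y\<bar> * std_normal_density (\<tau> * y))"
      using \<tau> \<sigma>(1) by (simp flip: ennreal_mult)
  qed
  also have "\<dots> = (\<integral>\<^sup>+y. ennreal (\<tau> * \<bar>y\<bar> * std_normal_density (\<tau> * y)) \<partial>gauss)"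
    by (subst nn_integral_density) auto
  also have "\<dots> \<le> P"
  proof -
    have "std_normal_density (- t * y / q) = std_normal_density (\<tau> * y)" for y
      by (simp add: std_normal_density_def \<tau>_def power_mult_distrib power_divide)
    then show ?thesis
      unfolding P using emeasure_gauss_interval(2)[OF sub S] by (intro nn_integral_mono) (simp only: abs)
  qed
  finally show "P \<ge> ennreal (\<tau> / (pi * (1 + \<tau>\<^sup>2)))" .
qed

section \<open>Small balls and double zeros\<close>

lemma emeasure_gauss_symmetric_le: "emeasure gauss {x. \<bar>c * x\<bar> \<le> e} \<le> ennreal (2 * e / \<bar>c\<bar>)" if "c \<noteq> 0" "0 \<le> e"
proof -
  have "emeasure gauss {x. \<bar>c * x\<bar> \<le> e} = (\<integral>\<^sup>+x. ennreal (std_normal_density x) * indicator {x. \<bar>c * x\<bar> \<le> e} x \<partial>lborel)"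
    by (simp add: emeasure_density)
  also have "\<dots> \<le> (\<integral>\<^sup>+x. indicator {- (e / \<bar>c\<bar>)..e / \<bar>c\<bar>} x \<partial>lborel)"
  proof (intro nn_integral_mono)
    fix x :: real
    have "std_normal_density x \<le> 1 / sqrt (2 * pi)"
      by (auto simp: std_normal_density_def divide_simps)
    also have "\<dots> \<le> 1"
      using pi_gt3 by simp
    finally have "ennreal (std_normal_density x) \<le> 1"
      by simp
    moreover have "x \<in> {- (e / \<bar>c\<bar>)..e / \<bar>c\<bar>}" if "\<bar>c * x\<bar> \<le> e"
    proof -
      have "\<bar>x\<bar> \<le> e / \<bar>c\<bar>"
        using that \<open>c \<noteq> 0\<close> by (simp add: abs_mult pos_le_divide_eq mult.commute)
      then show ?thesis
        by (simp add: abs_le_iff)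
    qed
    ultimately show "ennreal (std_normal_density x) * indicator {x. \<bar>c * x\<bar> \<le> e} x \<le> indicator {- (e / \<bar>c\<bar>)..e / \<bar>c\<bar>} x"
      by (auto simp: indicator_def)
  qed
  also have "\<dots> = ennreal (2 * e / \<bar>c\<bar>)"
    using that by simp
  finally show ?thesis .
qed

lemma finite_family_bounded_on_interval:
  fixes g :: "'i \<Rightarrow> real \<Rightarrow> real"
  assumes "finite I" "\<And>i. i \<in> I \<Longrightarrow> continuous_on UNIV (g i)"
  obtains C where "0 \<le> C" "\<And>i \<theta>. i \<in> I \<Longrightarrow> \<theta> \<in> {a..b} \<Longrightarrow> \<bar>g i \<theta>\<bar> \<le> C"
proof -
  have "\<exists>C. \<forall>\<theta>\<in>{a..b}. \<bar>g i \<theta>\<bar> \<le> C" if "i \<in> I" for i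
  proof -
    have "bounded (g i ` {a..b})"
      using assms(2)[OF that] by (intro compact_imp_bounded compact_continuous_image) (auto intro: continuous_on_subset)
    then show ?thesis
      by (auto simp: bounded_iff)
  qed
  then obtain c where c: "\<And>i \<theta>. i \<in> I \<Longrightarrow> \<theta> \<in> {a..b} \<Longrightarrow> \<bar>g i \<theta>\<bar> \<le> c i"
    by metis
  have "\<bar>g i \<theta>\<bar> \<le> (\<Sum>i\<in>I. \<bar>c i\<bar>)" if "i \<in> I" "\<theta> \<in> {a..b}" for i \<theta>
    using c[OF that] member_le_sum[of i I "\<lambda>i. \<bar>c i\<bar>"] that assms(1) by fastforce
  then show ?thesis
    by (intro that[of "\<Sum>i\<in>I. \<bar>c i\<bar>"]) (auto intro: sum_nonneg)
qed

context standard_normals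
begin

text \<open>Uncorrelated combinations have q = 0 in the Cholesky form, so their law is a product of
  centred normals of variances A and B, and each factor is bounded by the length of an
  interval.\<close>

lemma emeasure_small_ball:
  assumes AB: "0 < A" "0 < B" and e: "0 \<le> e" "0 \<le> d"
    and ab: "(\<Sum>i\<in>I. (a i)\<^sup>2) = A" "(\<Sum>i\<in>I. a i * b i) = 0" "(\<Sum>i\<in>I. (b i)\<^sup>2) = B"
  shows "emeasure M {\<omega>\<in>space M. \<bar>\<Sum>i\<in>I. X i \<omega> * a i\<bar> \<le> e \<and> \<bar>\<Sum>i\<in>I. X i \<omega> * b i\<bar> \<le> d}
    \<le> ennreal (4 * e * d / sqrt (A * B))"
proof -
  obtain r q t where rqt: "0 \<le> r" "r\<^sup>2 = (\<Sum>i\<in>I. (a i)\<^sup>2)" "r * q = (\<Sum>i\<in>I. a i * b i)"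
    "q\<^sup>2 + t\<^sup>2 = (\<Sum>i\<in>I. (b i)\<^sup>2)"
    and law: "\<And>S. S \<in> sets borel \<Longrightarrow>
      emeasure M {\<omega>\<in>space M. (\<Sum>i\<in>I. X i \<omega> * a i, \<Sum>i\<in>I. X i \<omega> * b i) \<in> S}
      = (\<integral>\<^sup>+x. \<integral>\<^sup>+y. indicator S (r * x, q * x + t * y) \<partial>gauss \<partial>gauss)"
    using emeasure_pair[of a b] by blast
  have r: "r \<noteq> 0"
    using rqt(2) ab AB by auto
  then have q: "q = 0"
    using rqt(3) ab by simp
  have t: "t\<^sup>2 = B" "t \<noteq> 0"
    using rqt(4) ab AB q by auto
  define S :: "(real \<times> real) set" where "S = {z. \<bar>fst z\<bar> \<le> e \<and> \<bar>snd z\<bar> \<le> d}"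
  have "closed S"
    unfolding S_def by (intro closed_Collect_conj closed_Collect_le continuous_intros)
  then have S: "S \<in> sets borel"
    by (rule borel_closed)
  have [measurable]: "{x. \<bar>r * x\<bar> \<le> e} \<in> sets borel" "{x. \<bar>t * x\<bar> \<le> d} \<in> sets borel"
    by measurable
  have "emeasure M {\<omega>\<in>space M. \<bar>\<Sum>i\<in>I. X i \<omega> * a i\<bar> \<le> e \<and> \<bar>\<Sum>i\<in>I. X i \<omega> * b i\<bar> \<le> d}
      = (\<integral>\<^sup>+x. \<integral>\<^sup>+y. indicator S (r * x, q * x + t * y) \<partial>gauss \<partial>gauss)"
    using law[OF S] by (simp add: S_def)
  also have "\<dots> = (\<integral>\<^sup>+x. \<integral>\<^sup>+y. indicator {x. \<bar>r * x\<bar> \<le> e} x * indicator {y. \<bar>t * y\<bar> \<le> d} y \<partial>gauss \<partial>gauss)"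
    by (intro nn_integral_cong) (auto simp: S_def q indicator_def)
  also have "\<dots> = emeasure gauss {x. \<bar>r * x\<bar> \<le> e} * emeasure gauss {y. \<bar>t * y\<bar> \<le> d}"
    by (simp add: nn_integral_cmult nn_integral_multc)
  also have "\<dots> \<le> ennreal (2 * e / \<bar>r\<bar>) * ennreal (2 * d / \<bar>t\<bar>)"
    using r t e by (intro mult_mono emeasure_gauss_symmetric_le) auto
  also have "\<dots> = ennreal (4 * e * d / (\<bar>r\<bar> * \<bar>t\<bar>))"
    using e by (simp flip: ennreal_mult)
  also have "\<bar>r\<bar> * \<bar>t\<bar> = sqrt (A * B)"
    using rqt(2) t(1) ab(1) by (metis real_sqrt_abs real_sqrt_mult)
  finally show ?thesis .
qed

text \<open>
  Bulinskaya's argument: at a double zero the process and its derivative are of orders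
  \<open>1/n\<^sup>2\<close> and \<open>1/n\<close> at a nearby point of the grid of mesh \<open>T/n\<close>, an event of
  probability \<open>O(1/n\<^sup>3)\<close> at each of the \<open>n + 1\<close> grid points.
\<close>

lemma AE_no_double_zero:
  fixes g g' g'' :: "'i \<Rightarrow> real \<Rightarrow> real"
  assumes T: "0 < T"
    and der: "\<And>i \<theta>. i \<in> I \<Longrightarrow> (g i has_real_derivative g' i \<theta>) (at \<theta>)"
      "\<And>i \<theta>. i \<in> I \<Longrightarrow> (g' i has_real_derivative g'' i \<theta>) (at \<theta>)"
    and cont: "\<And>i. i \<in> I \<Longrightarrow> continuous_on UNIV (g'' i)"
    and AB: "0 < A" "0 < B"
    and gram: "\<And>\<theta>. (\<Sum>i\<in>I. (g i \<theta>)\<^sup>2) = A" "\<And>\<theta>. (\<Sum>i\<in>I. g i \<theta> * g' i \<theta>) = 0"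
      "\<And>\<theta>. (\<Sum>i\<in>I. (g' i \<theta>)\<^sup>2) = B"
  shows "AE \<omega> in M. \<forall>\<theta>\<in>{0..T}. \<not> ((\<Sum>i\<in>I. X i \<omega> * g i \<theta>) = 0 \<and> (\<Sum>i\<in>I. X i \<omega> * g' i \<theta>) = 0)"
proof -
  obtain C where C: "0 \<le> C" "\<And>i \<theta>. i \<in> I \<Longrightarrow> \<theta> \<in> {0..T} \<Longrightarrow> \<bar>g'' i \<theta>\<bar> \<le> C"
    using finite_family_bounded_on_interval[OF finite_index, of g''] cont by blast
  define G G' where "G = (\<lambda>\<omega> \<theta>. \<Sum>i\<in>I. X i \<omega> * g i \<theta>)" and "G' = (\<lambda>\<omega> \<theta>. \<Sum>i\<in>I. X i \<omega> * g' i \<theta>)"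
  \<comment> \<open>The Lipschitz constant of \<open>G'\<close> is random. It is at most
    \<open>D m\<close> on the paths where the sum of the |X i| is at most m, and countably many m
    exhaust all paths; thus the events \<open>U m n\<close> can have deterministic
    thresholds.\<close>
  define D where "D = (\<lambda>m. C * real m)"
  define U where "U = (\<lambda>m n. \<Union>k\<in>{..n}. {\<omega>\<in>space M. \<bar>G \<omega> (real k * (T / real n))\<bar> \<le> D m * (T / real n)\<^sup>2
      \<and> \<bar>G' \<omega> (real k * (T / real n))\<bar> \<le> D m * (T / real n)})"
  have measG[measurable]: "(\<lambda>\<omega>. G \<omega> \<theta>) \<in> borel_measurable M" "(\<lambda>\<omega>. G' \<omega> \<theta>) \<in> borel_measurable M" for \<theta>
    unfolding G_def G'_def by (rule measurable_combination)+
  have U[measurable]: "U m n \<in> sets M" for m n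
    unfolding U_def by measurable
  have D: "0 \<le> D m" for m
    using C by (simp add: D_def)
  have "emeasure M (U m n) \<le> ennreal ((1 + real n) * (4 * (D m)\<^sup>2 * (T / real n) ^ 3 / sqrt (A * B)))" (is "_ \<le> ?u m n") for m n
  proof -
    have "emeasure M (U m n) \<le> (\<Sum>k\<in>{..n}. emeasure M {\<omega>\<in>space M. \<bar>G \<omega> (real k * (T / real n))\<bar> \<le> D m * (T / real n)\<^sup>2
      \<and> \<bar>G' \<omega> (real k * (T / real n))\<bar> \<le> D m * (T / real n)})"
      unfolding U_def by (rule emeasure_subadditive_finite) auto
    also have "\<dots> \<le> (\<Sum>k\<in>{..n}. ennreal (4 * (D m * (T / real n)\<^sup>2) * (D m * (T / real n)) / sqrt (A * B)))"
      unfolding G_def G'_def by (intro sum_mono emeasure_small_ball) (use AB D T gram in auto)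
    also have "\<dots> = ennreal ((1 + real n) * (4 * (D m * (T / real n)\<^sup>2) * (D m * (T / real n)) / sqrt (A * B)))"
      using D T AB by (subst sum_ennreal) (simp_all add: add.commute)
    finally show ?thesis
      by (simp add: power2_eq_square power3_eq_cube mult_ac)
  qed
  moreover have "(\<lambda>n. ennreal ((1 + real n) * (4 * (D m)\<^sup>2 * (T / real n) ^ 3 / sqrt (A * B)))) \<longlonglongrightarrow> ennreal 0" for m
  proof (rule tendsto_ennrealI)
    have "(\<lambda>n. (1 + real n) / real n ^ 3 * (4 * (D m)\<^sup>2 * T ^ 3 / sqrt (A * B))) \<longlonglongrightarrow> 0 * (4 * (D m)\<^sup>2 * T ^ 3 / sqrt (A * B))"
      by (intro tendsto_mult tendsto_const) real_asymp
    then show "(\<lambda>n. (1 + real n) * (4 * (D m)\<^sup>2 * (T / real n) ^ 3 / sqrt (A * B))) \<longlonglongrightarrow> 0"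
      by (simp add: power_divide mult_ac)
  qed
  ultimately have lim: "(\<lambda>n. emeasure M (U m n)) \<longlonglongrightarrow> 0" for m
    using tendsto_sandwich[of "\<lambda>_. 0" "\<lambda>n. emeasure M (U m n)" sequentially "?u m" 0] by simp
  \<comment> \<open>For suitable m a double zero puts the path into \<open>U m n\<close> for all n
    \<ge> 1 at once, so the intersection is what has to be null. The index n = 0 is left out because
    the mesh T / 0 is 0.\<close>
  have "emeasure M (\<Inter>n\<in>{1..}. U m n) \<le> 0" for m
  proof (rule tendsto_lowerbound[OF lim])
    show "\<forall>\<^sub>F n in sequentially. emeasure M (\<Inter>n\<in>{1..}. U m n) \<le> emeasure M (U m n)"
      using eventually_ge_at_top[of 1] by eventually_elim (auto intro!: emeasure_mono)
  qed simp
  then have "(\<Inter>n\<in>{1..}. U m n) \<in> null_sets M" for m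
    by (auto intro!: null_setsI)
  then have "AE \<omega> in M. \<forall>m. \<omega> \<notin> (\<Inter>n\<in>{1..}. U m n)"
    by (subst AE_all_countable) (intro allI AE_not_in)
  with AE_space show ?thesis
  proof (eventually_elim, intro ballI notI)
    fix \<omega> \<theta>
    assume space: "\<omega> \<in> space M" and \<omega>: "\<forall>m. \<omega> \<notin> (\<Inter>n\<in>{1..}. U m n)" and \<theta>: "\<theta> \<in> {0..T}"
      and zero: "(\<Sum>i\<in>I. X i \<omega> * g i \<theta>) = 0 \<and> (\<Sum>i\<in>I. X i \<omega> * g' i \<theta>) = 0"
    obtain m where m: "(\<Sum>i\<in>I. \<bar>X i \<omega>\<bar>) \<le> real m"
      using real_arch_simple by blast
    obtain n where n: "n \<ge> 1" "\<omega> \<notin> U m n"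
      using \<omega> by auto
    define \<delta> where "\<delta> = T / real n"
    have \<delta>: "0 < \<delta>" "real n * \<delta> = T"
      using T n by (auto simp: \<delta>_def)
    define k where "k = nat \<lfloor>\<theta> / \<delta>\<rfloor>"
    have "of_int \<lfloor>\<theta> / \<delta>\<rfloor> \<le> \<theta> / \<delta>" "\<theta> / \<delta> < of_int \<lfloor>\<theta> / \<delta>\<rfloor> + 1"
      by linarith+
    moreover have "0 \<le> \<theta> / \<delta>"
      using \<theta> \<delta> by simp
    ultimately have "real k \<le> \<theta> / \<delta>" "\<theta> / \<delta> < real k + 1"
      by (simp_all add: k_def)
    then have k: "real k * \<delta> \<le> \<theta>" "\<theta> \<le> real k * \<delta> + \<delta>"
      using \<delta>(1) by (simp_all add: field_simps)
    have "real k * \<delta> \<le> real n * \<delta>"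
      using k(1) \<theta> \<delta>(2) by simp
    then have "k \<le> n"
      using \<delta>(1) by simp
    define S where "S = {real k * \<delta>..\<theta>}"
    have S: "convex S" "real k * \<delta> \<in> S" "\<theta> \<in> S" "S \<subseteq> {0..T}"
      using k(1) \<theta> \<delta>(1) by (auto simp: S_def intro: order_trans[of 0 "real k * \<delta>"])
    have dist: "norm (\<phi> - \<theta>) \<le> \<delta>" if "\<phi> \<in> S" for \<phi>
      using that k(2) by (auto simp: S_def)
    \<comment> \<open>The mean value inequality is used twice between the grid point and \<theta>:
      for \<open>G'\<close>, which vanishes at \<theta> and has derivative at most
      \<open>D m\<close>, and then for \<open>G\<close>, whose derivative has just been bounded by
      \<open>D m * \<delta>\<close>.\<close>
    have G': "\<bar>G' \<omega> \<phi>\<bar> \<le> D m * \<delta>" if "\<phi> \<in> S" for \<phi>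
    proof -
      have "norm (G' \<omega> \<phi> - G' \<omega> \<theta>) \<le> D m * norm (\<phi> - \<theta>)"
      proof (rule field_differentiable_bound[OF S(1) _ _ that S(3)])
        fix z
        show "(G' \<omega> has_field_derivative (\<Sum>i\<in>I. X i \<omega> * g'' i z)) (at z within S)"
          unfolding G'_def by (intro DERIV_sum DERIV_cmult has_field_derivative_at_within[OF der(2)])
        assume z: "z \<in> S"
        have "norm (\<Sum>i\<in>I. X i \<omega> * g'' i z) \<le> (\<Sum>i\<in>I. \<bar>X i \<omega>\<bar> * C)"
          using z S(4) C by (intro sum_norm_le) (auto simp: abs_mult intro!: mult_left_mono)
        also have "\<dots> \<le> D m"
          using m C by (simp add: D_def mult.commute mult_left_mono flip: sum_distrib_left)
        finally show "norm (\<Sum>i\<in>I. X i \<omega> * g'' i z) \<le> D m" .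
      qed
      also have "\<dots> \<le> D m * \<delta>"
        using dist[OF that] D by (intro mult_left_mono)
      finally show ?thesis
        using zero by (simp add: G'_def)
    qed
    have "norm (G \<omega> (real k * \<delta>) - G \<omega> \<theta>) \<le> D m * \<delta> * norm (real k * \<delta> - \<theta>)"
    proof (rule field_differentiable_bound[OF S(1) _ _ S(2,3)])
      fix z
      show "(G \<omega> has_field_derivative G' \<omega> z) (at z within S)"
        unfolding G_def G'_def by (intro DERIV_sum DERIV_cmult has_field_derivative_at_within[OF der(1)])
    qed (use G' in auto)
    also have "\<dots> \<le> D m * \<delta> * \<delta>"
      using dist[OF S(2)] D \<delta> by (intro mult_left_mono) auto
    finally have "\<bar>G \<omega> (real k * \<delta>)\<bar> \<le> D m * \<delta>\<^sup>2"
      using zero by (simp add: G_def power2_eq_square mult.assoc)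
    then have "\<omega> \<in> U m n"
      using G'[OF S(2)] \<open>k \<le> n\<close> space by (auto simp: U_def \<delta>_def)
    with n show False
      by simp
  qed
qed

end

section \<open>Counting points by grid cells, and measurability of the count\<close>

text \<open>\<open>J n\<close> is a set of flagged cells. Cells are disjoint and each flagged one
  contains a point of \<open>Z\<close>, so their number never exceeds the count. Conversely the
  points of a finite subset of \<open>Z\<close> eventually lie in different flagged cells; letting
  the subset grow covers infinite \<open>Z\<close>. The flags are sign changes in one application
  and plain hits in the other.\<close>

lemma count_eq_liminf_cells:
  fixes Z :: "real set" and J :: "nat \<Rightarrow> nat set"
  assumes T: "0 < T"
    and J: "\<And>n k. 0 < n \<Longrightarrow> k \<in> J n \<Longrightarrow> k < n"
      "\<And>n k. 0 < n \<Longrightarrow> k \<in> J n \<Longrightarrow> \<exists>z\<in>Z. real k * T / real n \<le> z \<and> z < real (Suc k) * T / real n"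
    and Z: "Z \<subseteq> {0..<T}"
      "\<And>z. z \<in> Z \<Longrightarrow> \<forall>\<^sub>F n in sequentially. \<forall>k<n.
        real k * T / real n \<le> z \<and> z < real (Suc k) * T / real n \<longrightarrow> k \<in> J n"
  shows card_cells_le_count: "\<And>n. 0 < n \<Longrightarrow> of_nat (card (J n)) \<le> emeasure (count_space UNIV) Z"
    and "emeasure (count_space UNIV) Z = liminf (\<lambda>n. of_nat (card (J n)))"
proof -
  have le: "of_nat (card (J n)) \<le> emeasure (count_space UNIV) Z" if n: "0 < n" for n
  proof -
    obtain z where z: "\<And>k. k \<in> J n \<Longrightarrow> z k \<in> Z \<and> real k * T / real n \<le> z k \<and> z k < real (Suc k) * T / real n"
      using J(2)[OF n] by metis
    have less: "z k < z l" if "k \<in> J n" "l \<in> J n" "k < l" for k l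
    proof -
      have "real (Suc k) * T / real n \<le> real l * T / real n"
        using that T n by (intro divide_right_mono mult_right_mono) auto
      then show ?thesis
        using z[OF that(1)] z[OF that(2)] by linarith
    qed
    have "inj_on z (J n)"
    proof (rule inj_onI, rule ccontr)
      fix k l
      assume "k \<in> J n" "l \<in> J n" "z k = z l" "k \<noteq> l"
      then show False
        using less[of k l] less[of l k] by (cases "k < l") auto
    qed
    moreover have "finite (J n)"
      using finite_subset[of "J n" "{..<n}"] J(1)[OF n] by auto
    ultimately have "of_nat (card (J n)) = emeasure (count_space UNIV) (z ` J n)"
      by (simp add: emeasure_count_space_finite card_image)
    also have "\<dots> \<le> emeasure (count_space UNIV) Z"
      using z by (intro emeasure_mono) auto
    finally show ?thesis .
  qed
  then show "\<And>n. 0 < n \<Longrightarrow> of_nat (card (J n)) \<le> emeasure (count_space UNIV) Z" .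
  have ge: "\<forall>\<^sub>F n in sequentially. card F \<le> card (J n)" if F: "finite F" "F \<subseteq> Z" for F
  proof -
    have "\<forall>\<^sub>F n in sequentially. \<forall>z\<in>F. \<forall>k<n.
        real k * T / real n \<le> z \<and> z < real (Suc k) * T / real n \<longrightarrow> k \<in> J n"
      using F Z(2) by (intro eventually_ball_finite) auto
    moreover have "\<forall>\<^sub>F n in sequentially. \<forall>z\<in>F. \<forall>w\<in>F. z \<noteq> w \<longrightarrow> T / real n < \<bar>z - w\<bar>"
    proof (intro eventually_ball_finite F ballI)
      fix z w
      have "(\<lambda>n. T / real n) \<longlonglongrightarrow> 0"
        by real_asymp
      then show "\<forall>\<^sub>F n in sequentially. z \<noteq> w \<longrightarrow> T / real n < \<bar>z - w\<bar>"
        by (cases "z = w") (auto dest: order_tendstoD(2)[of _ _ _ "\<bar>z - w\<bar>"])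
    qed
    moreover have "\<forall>\<^sub>F n in sequentially. 0 < n"
      by (rule eventually_gt_at_top)
    ultimately show ?thesis
    proof eventually_elim
      case (elim n)
      define c where "c = (\<lambda>z. nat \<lfloor>z * real n / T\<rfloor>)"
      have c: "c z < n \<and> real (c z) * T / real n \<le> z \<and> z < real (Suc (c z)) * T / real n" if "z \<in> F" for z
      proof -
        have z: "0 \<le> z" "z < T"
          using that F Z(1) by auto
        have bounds: "real (c z) \<le> z * real n / T" "z * real n / T < real (Suc (c z))"
          using z T unfolding c_def by (auto simp: of_nat_nat) linarith+
        have "z * real n / T < real n"
          using T z elim(3) by (simp add: pos_divide_less_eq mult.commute)
        with bounds(1) have "real (c z) < real n"
          by (rule le_less_trans)
        then have "c z < n"
          by simp
        moreover have "real (c z) * T \<le> z * real n" "z * real n < real (Suc (c z)) * T"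
          using bounds T by (simp_all add: pos_le_divide_eq pos_divide_less_eq del: of_nat_Suc)
        ultimately show ?thesis
          using elim(3) by (simp add: pos_divide_le_eq pos_less_divide_eq del: of_nat_Suc)
      qed
      have "inj_on c F"
      proof (rule inj_onI, rule ccontr)
        fix z w
        assume zw: "z \<in> F" "w \<in> F" "c z = c w" "z \<noteq> w"
        have "real (Suc (c z)) * T / real n = real (c z) * T / real n + T / real n"
          by (simp add: distrib_right add_divide_distrib)
        then have "\<bar>z - w\<bar> < T / real n"
          using c[OF zw(1)] c[OF zw(2)] zw(3) by simp linarith
        with elim(2) zw show False
          by force
      qed
      moreover have "c ` F \<subseteq> J n"
        using elim(1) c by blast
      moreover have "finite (J n)"
        using finite_subset[of "J n" "{..<n}"] J(1)[OF elim(3)] by auto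
      ultimately show ?case
        using card_inj_on_le by blast
    qed
  qed
  have lower: "of_nat (card F) \<le> liminf (\<lambda>n. of_nat (card (J n)) :: ennreal)" if "finite F" "F \<subseteq> Z" for F
    using ge[OF that] by (intro Liminf_bounded) (auto elim: eventually_mono)
  have "emeasure (count_space UNIV) Z \<le> liminf (\<lambda>n. of_nat (card (J n)))"
  proof (cases "finite Z")
    case True
    then show ?thesis
      using lower[of Z] by (simp add: emeasure_count_space_finite)
  next
    case False
    have "of_nat m \<le> liminf (\<lambda>n. of_nat (card (J n)) :: ennreal)" for m
      using infinite_arbitrarily_large[OF False, of m] lower by auto
    then have "(SUP m. of_nat m) \<le> liminf (\<lambda>n. of_nat (card (J n)) :: ennreal)"
      by (intro SUP_least)
    then show ?thesis
      by (simp add: ennreal_SUP_of_nat_eq_top top_unique)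
  qed
  moreover have "liminf (\<lambda>n. of_nat (card (J n))) \<le> emeasure (count_space UNIV) Z"
    by (rule order_trans[OF Liminf_le_Limsup Limsup_bounded])
      (auto intro: eventually_mono[OF eventually_gt_at_top[of 0]] le)
  ultimately show "emeasure (count_space UNIV) Z = liminf (\<lambda>n. of_nat (card (J n)))"
    by (rule antisym)
qed

text \<open>With every hit cell flagged, the count is the lower limit of the numbers of hit cells,
  which are finite sums of indicators of measurable events.\<close>

lemma borel_measurable_count:
  fixes P :: "'a \<Rightarrow> real \<Rightarrow> bool"
  assumes T: "0 < T"
    and hit: "\<And>a b. {\<omega>\<in>space M. \<exists>\<theta>\<in>{a..<b}. P \<omega> \<theta>} \<in> sets M"
  shows "(\<lambda>\<omega>. emeasure (count_space UNIV) {\<theta>\<in>{0..<T}. P \<omega> \<theta>}) \<in> borel_measurable M"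
proof -
  define hits where "hits = (\<lambda>\<omega> n k. \<exists>\<theta>\<in>{real k * T / real n..<real (Suc k) * T / real n}. P \<omega> \<theta>)"
  have [measurable]: "Measurable.pred M (\<lambda>\<omega>. hits \<omega> n k)" for n k
    unfolding hits_def pred_def by (rule hit)
  have "emeasure (count_space UNIV) {\<theta>\<in>{0..<T}. P \<omega> \<theta>} = liminf (\<lambda>n. of_nat (card {k\<in>{..<n}. hits \<omega> n k}))" for \<omega>
  proof (rule count_eq_liminf_cells(2)[OF T])
    fix n k :: nat
    assume n: "0 < n" "k \<in> {k\<in>{..<n}. hits \<omega> n k}"
    then have "real (Suc k) * T \<le> real n * T"
      using T by (intro mult_right_mono) auto
    then have "real (Suc k) * T / real n \<le> T"
      using n by (simp add: divide_le_eq mult.commute)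
    moreover have "0 \<le> real k * T / real n"
      using T by simp
    moreover obtain z where "real k * T / real n \<le> z" "z < real (Suc k) * T / real n" "P \<omega> z"
      using n unfolding hits_def by auto
    ultimately show "\<exists>z\<in>{\<theta>\<in>{0..<T}. P \<omega> \<theta>}. real k * T / real n \<le> z \<and> z < real (Suc k) * T / real n"
      by (intro bexI[of _ z]) auto
  qed (auto simp: hits_def intro!: always_eventually bexI)
  moreover have "(\<lambda>\<omega>. liminf (\<lambda>n. of_nat (card {k\<in>{..<n}. hits \<omega> n k})) :: ennreal) \<in> borel_measurable M"
  proof -
    have "(of_nat (card {k\<in>{..<n}. hits \<omega> n k}) :: ennreal) = (\<Sum>k<n. if hits \<omega> n k then 1 else 0)" for \<omega> n
      by (simp flip: sum.inter_filter)
    then show ?thesis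
      by (simp only:) measurable
  qed
  ultimately show ?thesis
    by simp
qed

text \<open>The existential over an uncountable interval becomes countable: by compactness a zero
  exists iff |g| takes arbitrarily small values, and by continuity a countable dense subset detects
  these.\<close>

lemma sets_hits_zero:
  fixes g :: "'a \<Rightarrow> real \<Rightarrow> real"
  assumes meas[measurable]: "\<And>\<theta>. (\<lambda>\<omega>. g \<omega> \<theta>) \<in> borel_measurable M"
    and cont: "\<And>\<omega>. \<omega> \<in> space M \<Longrightarrow> continuous_on UNIV (g \<omega>)"
  shows "{\<omega>\<in>space M. \<exists>\<theta>\<in>{a..b}. g \<omega> \<theta> = 0} \<in> sets M"
proof -
  obtain D where D: "countable D" "D \<subseteq> {a..b}" "{a..b} \<subseteq> closure D"
    using separable[of "{a..b}"] by blast
  have iff: "(\<exists>\<theta>\<in>{a..b}. g \<omega> \<theta> = 0) \<longleftrightarrow> (\<forall>j. \<exists>\<theta>\<in>D. \<bar>g \<omega> \<theta>\<bar> < inverse (real (Suc j)))" if \<omega>: "\<omega> \<in> space M" for \<omega>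
  proof
    assume "\<exists>\<theta>\<in>{a..b}. g \<omega> \<theta> = 0"
    then obtain \<theta> where \<theta>: "\<theta> \<in> {a..b}" "g \<omega> \<theta> = 0"
      by blast
    show "\<forall>j. \<exists>\<theta>\<in>D. \<bar>g \<omega> \<theta>\<bar> < inverse (real (Suc j))"
    proof
      fix j
      have "open {t. \<bar>g \<omega> t\<bar> < inverse (real (Suc j))}"
        using cont[OF \<omega>] by (intro open_Collect_less continuous_intros) auto
      moreover have "\<theta> \<in> {t. \<bar>g \<omega> t\<bar> < inverse (real (Suc j))}" "\<theta> \<in> closure D"
        using \<theta> D by auto
      ultimately show "\<exists>\<theta>\<in>D. \<bar>g \<omega> \<theta>\<bar> < inverse (real (Suc j))"
        using open_Int_closure_eq_empty by blast
    qed
  next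
    assume *: "\<forall>j. \<exists>\<theta>\<in>D. \<bar>g \<omega> \<theta>\<bar> < inverse (real (Suc j))"
    then have "{a..b} \<noteq> {}"
      using D(2) by blast
    moreover have "continuous_on {a..b} (\<lambda>t. \<bar>g \<omega> t\<bar>)"
      using cont[OF \<omega>] by (intro continuous_intros) (auto intro: continuous_on_subset)
    ultimately obtain \<theta> where \<theta>: "\<theta> \<in> {a..b}" "\<And>t. t \<in> {a..b} \<Longrightarrow> \<bar>g \<omega> \<theta>\<bar> \<le> \<bar>g \<omega> t\<bar>"
      using continuous_attains_inf[of "{a..b}"] by (metis compact_Icc)
    have "\<bar>g \<omega> \<theta>\<bar> < inverse (real (Suc j))" for j
      using * \<theta>(2) D(2) by (meson le_less_trans subsetD)
    then have "g \<omega> \<theta> = 0"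
      using reals_Archimedean[of "\<bar>g \<omega> \<theta>\<bar>"] by (metis less_asym zero_less_abs_iff)
    with \<theta> show "\<exists>\<theta>\<in>{a..b}. g \<omega> \<theta> = 0"
      by blast
  qed
  have "{\<omega>\<in>space M. \<forall>j. \<exists>\<theta>\<in>D. \<bar>g \<omega> \<theta>\<bar> < inverse (real (Suc j))} \<in> sets M"
    using D(1) by measurable
  then show ?thesis
    using iff by (simp cong: conj_cong)
qed

lemma sets_hits_zero_nonzero:
  fixes g h :: "'a \<Rightarrow> real \<Rightarrow> real"
  assumes meas[measurable]: "\<And>\<theta>. (\<lambda>\<omega>. g \<omega> \<theta>) \<in> borel_measurable M" "\<And>\<theta>. (\<lambda>\<omega>. h \<omega> \<theta>) \<in> borel_measurable M"
    and cont: "\<And>\<omega>. \<omega> \<in> space M \<Longrightarrow> continuous_on UNIV (g \<omega>)" "\<And>\<omega>. \<omega> \<in> space M \<Longrightarrow> continuous_on UNIV (h \<omega>)"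
  shows "{\<omega>\<in>space M. \<exists>\<theta>\<in>{a..<b}. g \<omega> \<theta> = 0 \<and> h \<omega> \<theta> \<noteq> 0} \<in> sets M"
proof -
  \<comment> \<open>The conditions \<theta> < b and h \<noteq> 0 are not closed; they are exhausted
    by \<theta> \<le> b - 1/(l+1) and |h| \<ge> 1/(m+1). The continuous function \<open>w m\<close>
    vanishes exactly where g = 0 and |h| \<ge> 1/(m+1), which reduces everything to zeros of one
    function on a compact interval.\<close>
  define w where "w = (\<lambda>m \<omega> \<theta>. \<bar>g \<omega> \<theta>\<bar> + max 0 (inverse (real (Suc m)) - \<bar>h \<omega> \<theta>\<bar>))"
  have "{\<omega>\<in>space M. \<exists>\<theta>\<in>{a..b - inverse (real (Suc l))}. w m \<omega> \<theta> = 0} \<in> sets M" for l m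
    using cont by (intro sets_hits_zero) (auto simp: w_def intro!: continuous_intros)
  then have "(\<Union>l. \<Union>m. {\<omega>\<in>space M. \<exists>\<theta>\<in>{a..b - inverse (real (Suc l))}. w m \<omega> \<theta> = 0}) \<in> sets M"
    by auto
  moreover have "(\<Union>l. \<Union>m. {\<omega>\<in>space M. \<exists>\<theta>\<in>{a..b - inverse (real (Suc l))}. w m \<omega> \<theta> = 0})
      = {\<omega>\<in>space M. \<exists>\<theta>\<in>{a..<b}. g \<omega> \<theta> = 0 \<and> h \<omega> \<theta> \<noteq> 0}"
  proof -
    have w: "(\<exists>m. w m \<omega> \<theta> = 0) \<longleftrightarrow> g \<omega> \<theta> = 0 \<and> h \<omega> \<theta> \<noteq> 0" for \<omega> \<theta>
    proof -
      have "w m \<omega> \<theta> = 0 \<longleftrightarrow> g \<omega> \<theta> = 0 \<and> inverse (real (Suc m)) \<le> \<bar>h \<omega> \<theta>\<bar>" for m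
        unfolding w_def by linarith
      moreover have "(\<exists>m. inverse (real (Suc m)) \<le> \<bar>h \<omega> \<theta>\<bar>) \<longleftrightarrow> h \<omega> \<theta> \<noteq> 0"
        using reals_Archimedean[of "\<bar>h \<omega> \<theta>\<bar>"]
        by (metis abs_zero inverse_positive_iff_positive less_le_not_le of_nat_0_less_iff zero_less_Suc zero_less_abs_iff)
      ultimately show ?thesis
        by simp
    qed
    have l: "\<theta> \<in> {a..<b} \<longleftrightarrow> (\<exists>l. \<theta> \<in> {a..b - inverse (real (Suc l))})" for \<theta>
    proof -
      have "(\<exists>l. inverse (real (Suc l)) \<le> b - \<theta>) \<longleftrightarrow> 0 < b - \<theta>"
        using reals_Archimedean[of "b - \<theta>"]
        by (metis inverse_positive_iff_positive less_le_trans less_imp_le of_nat_0_less_iff zero_less_Suc)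
      then show ?thesis
        by (auto simp: algebra_simps)
    qed
    show ?thesis
      unfolding w[symmetric] Bex_def l by blast
  qed
  ultimately show ?thesis
    by simp
qed

section \<open>Sign changes and expected zero counts\<close>

lemma simple_zero_sign_change:
  fixes G :: "real \<Rightarrow> real"
  assumes "(G has_real_derivative l) (at z)" "l \<noteq> 0" "G z = 0"
  obtains d where "0 < d" "\<And>x y. z - d < x \<Longrightarrow> x < z \<Longrightarrow> z < y \<Longrightarrow> y < z + d \<Longrightarrow> G x * G y < 0"
proof (cases "0 < l")
  case True
  obtain d where d: "0 < d" "\<And>h. 0 < h \<Longrightarrow> h < d \<Longrightarrow> G z < G (z + h)"
    using DERIV_pos_inc_right[OF assms(1) True] by blast
  obtain e where e: "0 < e" "\<And>h. 0 < h \<Longrightarrow> h < e \<Longrightarrow> G (z - h) < G z"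
    using DERIV_pos_inc_left[OF assms(1) True] by blast
  show ?thesis
  proof (rule that[of "min d e"])
    fix x y assume "z - min d e < x" "x < z" "z < y" "y < z + min d e"
    then show "G x * G y < 0"
      using d(2)[of "y - z"] e(2)[of "z - x"] assms(3) by (simp add: mult_neg_pos)
  qed (use d e in simp)
next
  case False
  then have l: "l < 0"
    using assms by simp
  obtain d where d: "0 < d" "\<And>h. 0 < h \<Longrightarrow> h < d \<Longrightarrow> G (z + h) < G z"
    using DERIV_neg_dec_right[OF assms(1) l] by blast
  obtain e where e: "0 < e" "\<And>h. 0 < h \<Longrightarrow> h < e \<Longrightarrow> G z < G (z - h)"
    using DERIV_neg_dec_left[OF assms(1) l] by blast
  show ?thesis
  proof (rule that[of "min d e"])
    fix x y assume "z - min d e < x" "x < z" "z < y" "y < z + min d e"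
    then show "G x * G y < 0"
      using d(2)[of "y - z"] e(2)[of "z - x"] assms(3) by (simp add: mult_pos_neg)
  qed (use d e in simp)
qed

text \<open>The intermediate value theorem puts a zero into each cell with a sign change, and a
  simple zero forces a sign change around it once the mesh is small. Both directions need
  \<open>grid\<close>: otherwise the zero could be the excluded right end of its cell, or make the
  product 0 instead of negative.\<close>

lemma count_zeros_eq_liminf_sign_changes:
  fixes G G' :: "real \<Rightarrow> real"
  assumes T: "0 < T"
    and der: "\<And>\<theta>. (G has_real_derivative G' \<theta>) (at \<theta>)"
    and simple: "\<And>\<theta>. \<theta> \<in> {0..T} \<Longrightarrow> G \<theta> = 0 \<Longrightarrow> G' \<theta> \<noteq> 0"
    and grid: "\<And>n k. G (real k * T / real n) \<noteq> 0"
  defines "J \<equiv> \<lambda>n. {k\<in>{..<n}. G (real k * T / real n) * G (real (Suc k) * T / real n) < 0}"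
  shows card_sign_changes_le_count_zeros:
      "\<And>n. 0 < n \<Longrightarrow> of_nat (card (J n)) \<le> emeasure (count_space UNIV) {\<theta>\<in>{0..<T}. G \<theta> = 0}"
    and "emeasure (count_space UNIV) {\<theta>\<in>{0..<T}. G \<theta> = 0} = liminf (\<lambda>n. of_nat (card (J n)))"
proof -
  have J: "k < n" if "k \<in> J n" for n k
    using that by (simp add: J_def)
  have hit: "\<exists>z\<in>{\<theta>\<in>{0..<T}. G \<theta> = 0}. real k * T / real n \<le> z \<and> z < real (Suc k) * T / real n"
    if n: "0 < n" and k: "k \<in> J n" for n k
  proof -
    define a b where "a = real k * T / real n" and "b = real (Suc k) * T / real n"
    have ab: "a \<le> b"
      using T n unfolding a_def b_def by (intro divide_right_mono mult_right_mono) auto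
    have cont: "continuous_on {a..b} G"
      using der by (meson DERIV_isCont continuous_at_imp_continuous_on)
    have "\<exists>z. a \<le> z \<and> z \<le> b \<and> G z = 0"
    proof (cases "G a < 0")
      case True
      then have "0 < G b"
        using k by (auto simp: J_def a_def b_def mult_less_0_iff)
      then show ?thesis
        using IVT'[of G a 0 b] True ab cont by auto
    next
      case False
      then have "G b < 0"
        using k by (auto simp: J_def a_def b_def mult_less_0_iff)
      then show ?thesis
        using IVT2'[of G b 0 a] False ab cont by auto
    qed
    then obtain z where z: "a \<le> z" "z \<le> b" "G z = 0"
      by blast
    moreover have "z \<noteq> b"
      using z(3) grid b_def by blast
    moreover have "0 \<le> a"
      using T by (simp add: a_def)
    moreover have "b \<le> T"
    proof -
      have "real (Suc k) * T \<le> real n * T"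
        using J[OF k] T by (intro mult_right_mono) auto
      then show ?thesis
        using n unfolding b_def by (simp add: divide_le_eq mult.commute)
    qed
    ultimately show ?thesis
      unfolding a_def[symmetric] b_def[symmetric] by (intro bexI[of _ z]) auto
  qed
  have ev: "\<forall>\<^sub>F n in sequentially. \<forall>k<n.
      real k * T / real n \<le> z \<and> z < real (Suc k) * T / real n \<longrightarrow> k \<in> J n"
    if z: "z \<in> {\<theta>\<in>{0..<T}. G \<theta> = 0}" for z
  proof -
    have "G' z \<noteq> 0"
      using z simple by auto
    then obtain d where d: "0 < d" "\<And>x y. z - d < x \<Longrightarrow> x < z \<Longrightarrow> z < y \<Longrightarrow> y < z + d \<Longrightarrow> G x * G y < 0"
      using simple_zero_sign_change[OF der] z by blast
    have "(\<lambda>n. T / real n) \<longlonglongrightarrow> 0"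
      by real_asymp
    then have "\<forall>\<^sub>F n in sequentially. T / real n < d"
      using d(1) by (rule order_tendstoD(2))
    then show ?thesis
    proof (eventually_elim, intro allI impI)
      fix n k :: nat
      assume n: "T / real n < d" "k < n" and k: "real k * T / real n \<le> z \<and> z < real (Suc k) * T / real n"
      have "real (Suc k) * T / real n = real k * T / real n + T / real n"
        by (simp add: distrib_right add_divide_distrib)
      moreover have "real k * T / real n \<noteq> z"
        using z grid by blast
      ultimately have "G (real k * T / real n) * G (real (Suc k) * T / real n) < 0"
        using n k by (intro d(2)) linarith+
      then show "k \<in> J n"
        using n by (simp add: J_def)
    qed
  qed
  have sub: "{\<theta>\<in>{0..<T}. G \<theta> = 0} \<subseteq> {0..<T}"
    by auto
  show "\<And>n. 0 < n \<Longrightarrow> of_nat (card (J n)) \<le> emeasure (count_space UNIV) {\<theta>\<in>{0..<T}. G \<theta> = 0}"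
    by (rule card_cells_le_count[OF T J hit sub ev])
  show "emeasure (count_space UNIV) {\<theta>\<in>{0..<T}. G \<theta> = 0} = liminf (\<lambda>n. of_nat (card (J n)))"
    by (rule count_eq_liminf_cells(2)[OF T J hit sub ev])
qed

context standard_normals
begin

text \<open>R / A is the correlation of the two combinations, hence the cosine of an acute angle,
  and \<tau> is the tangent of that angle; in the Cholesky form it is |t| / q.\<close>

lemma emeasure_sign_change:
  assumes AR: "0 < A" "0 < R"
    and ab: "(\<Sum>i\<in>I. (a i)\<^sup>2) = A" "(\<Sum>i\<in>I. a i * b i) = R" "(\<Sum>i\<in>I. (b i)\<^sup>2) = A"
  defines "\<tau> \<equiv> sqrt ((A / R)\<^sup>2 - 1)"
  defines "P \<equiv> emeasure M {\<omega>\<in>space M. (\<Sum>i\<in>I. X i \<omega> * a i) * (\<Sum>i\<in>I. X i \<omega> * b i) < 0}"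
  shows "P \<le> ennreal (\<tau> / pi)" and "P \<ge> ennreal (\<tau> / (pi * (1 + \<tau>\<^sup>2)))"
proof -
  obtain r q t where rqt: "0 \<le> r" "r\<^sup>2 = (\<Sum>i\<in>I. (a i)\<^sup>2)" "r * q = (\<Sum>i\<in>I. a i * b i)"
    "q\<^sup>2 + t\<^sup>2 = (\<Sum>i\<in>I. (b i)\<^sup>2)"
    and law: "\<And>S. S \<in> sets borel \<Longrightarrow>
      emeasure M {\<omega>\<in>space M. (\<Sum>i\<in>I. X i \<omega> * a i, \<Sum>i\<in>I. X i \<omega> * b i) \<in> S}
      = (\<integral>\<^sup>+x. \<integral>\<^sup>+y. indicator S (r * x, q * x + t * y) \<partial>gauss \<partial>gauss)"
    using emeasure_pair[of a b] by blast
  have r: "0 < r"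
    using rqt(1,2) ab AR by (cases "r = 0") auto
  have q: "0 < q"
    using rqt(3) ab AR r by (metis zero_less_mult_pos)
  have "\<bar>t\<bar> / q = \<tau>"
  proof -
    have A: "A = r\<^sup>2" "R = r * q"
      using rqt ab by auto
    then have "A / R = r / q"
      using r by (simp add: power2_eq_square)
    then have "(A / R)\<^sup>2 - 1 = (r\<^sup>2 - q\<^sup>2) / q\<^sup>2"
      using q by (simp add: power_divide diff_divide_distrib)
    also have "r\<^sup>2 - q\<^sup>2 = t\<^sup>2"
      using rqt(4) ab A by simp
    finally show ?thesis
      using q by (simp add: \<tau>_def real_sqrt_divide)
  qed
  moreover have "P = (\<integral>\<^sup>+x. \<integral>\<^sup>+y. indicator {z. fst z * snd z < 0} (r * x, q * x + t * y) \<partial>gauss \<partial>gauss)"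
  proof -
    have "open {z :: real \<times> real. fst z * snd z < 0}"
      by (intro open_Collect_less continuous_intros)
    then show ?thesis
      unfolding P_def by (simp flip: law[OF borel_open])
  qed
  ultimately show "P \<le> ennreal (\<tau> / pi)" "P \<ge> ennreal (\<tau> / (pi * (1 + \<tau>\<^sup>2)))"
    using gauss_wedge[OF r q, of t] by simp_all
qed

text \<open>The small ball estimate with first radius 0 gives null events. The second radius m runs
  through the naturals, so that in the end the auxiliary uncorrelated combination is
  unrestricted.\<close>

lemma AE_combination_nonzero:
  assumes AB: "0 < A" "0 < B"
    and ab: "(\<Sum>i\<in>I. (a i)\<^sup>2) = A" "(\<Sum>i\<in>I. a i * b i) = 0" "(\<Sum>i\<in>I. (b i)\<^sup>2) = B"
  shows "AE \<omega> in M. (\<Sum>i\<in>I. X i \<omega> * a i) \<noteq> 0"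
proof -
  define U where "U = (\<lambda>m. {\<omega>\<in>space M. \<bar>\<Sum>i\<in>I. X i \<omega> * a i\<bar> \<le> 0 \<and> \<bar>\<Sum>i\<in>I. X i \<omega> * b i\<bar> \<le> real m})"
  have [measurable]: "(\<lambda>\<omega>. \<Sum>i\<in>I. X i \<omega> * a i) \<in> borel_measurable M" "(\<lambda>\<omega>. \<Sum>i\<in>I. X i \<omega> * b i) \<in> borel_measurable M"
    by (rule measurable_combination)+
  have "U m \<in> null_sets M" for m
  proof (rule null_setsI)
    show "emeasure M (U m) = 0"
      using emeasure_small_ball[OF AB order_refl _ ab, of "real m"] by (simp add: U_def)
    show "U m \<in> sets M"
      unfolding U_def by measurable
  qed
  then have "AE \<omega> in M. \<forall>m. \<omega> \<notin> U m"
    by (subst AE_all_countable) (intro allI AE_not_in)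
  with AE_space show ?thesis
  proof eventually_elim
    case (elim \<omega>)
    obtain m where "\<bar>\<Sum>i\<in>I. X i \<omega> * b i\<bar> \<le> real m"
      using real_arch_simple by blast
    with elim show ?case
      by (auto simp: U_def)
  qed
qed

text \<open>
  A Kac--Rice formula. As the zeros of \<open>\<Sum>i. X i * f1 i \<theta>\<close> are almost surely simple, their number
  is the limit of the number of sign changes along finer and finer grids; the expectation of the
  latter is governed by the wedge probabilities.
\<close>

theorem expected_count_critical:
  fixes f f1 f2 f3 :: "'i \<Rightarrow> real \<Rightarrow> real"
  assumes T: "0 < T"
    and der: "\<And>i \<theta>. i \<in> I \<Longrightarrow> (f i has_real_derivative f1 i \<theta>) (at \<theta>)"
      "\<And>i \<theta>. i \<in> I \<Longrightarrow> (f1 i has_real_derivative f2 i \<theta>) (at \<theta>)"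
      "\<And>i \<theta>. i \<in> I \<Longrightarrow> (f2 i has_real_derivative f3 i \<theta>) (at \<theta>)"
    and cont: "\<And>i. i \<in> I \<Longrightarrow> continuous_on UNIV (f3 i)"
    and A: "0 < A0" "0 < A1" "0 < A2"
    and gram: "\<And>\<theta>. (\<Sum>i\<in>I. (f i \<theta>)\<^sup>2) = A0" "\<And>\<theta>. (\<Sum>i\<in>I. (f1 i \<theta>)\<^sup>2) = A1"
      "\<And>\<theta>. (\<Sum>i\<in>I. (f2 i \<theta>)\<^sup>2) = A2"
      "\<And>\<theta>. (\<Sum>i\<in>I. f i \<theta> * f1 i \<theta>) = 0" "\<And>\<theta>. (\<Sum>i\<in>I. f1 i \<theta> * f2 i \<theta>) = 0"
    and cov: "\<And>\<theta> \<delta>. (\<Sum>i\<in>I. f1 i \<theta> * f1 i (\<theta> + \<delta>)) = R \<delta>"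
    and R_pos: "\<forall>\<^sub>F n in sequentially. 0 < R (T / real n)"
    and lim: "(\<lambda>n. real n * sqrt ((A1 / R (T / real n))\<^sup>2 - 1)) \<longlonglongrightarrow> pi * L"
  defines "N \<equiv> \<lambda>\<omega>. emeasure (count_space UNIV)
    {\<theta>\<in>{0..<T}. (\<Sum>i\<in>I. X i \<omega> * f1 i \<theta>) = 0 \<and> (\<Sum>i\<in>I. X i \<omega> * f i \<theta>) \<noteq> 0}"
  shows "N \<in> borel_measurable M" and "(\<integral>\<^sup>+\<omega>. N \<omega> \<partial>M) = ennreal L"
proof -
  define F where "F = (\<lambda>\<omega> \<theta>. \<Sum>i\<in>I. X i \<omega> * f i \<theta>)"
  define G where "G = (\<lambda>\<omega> \<theta>. \<Sum>i\<in>I. X i \<omega> * f1 i \<theta>)"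
  define G' where "G' = (\<lambda>\<omega> \<theta>. \<Sum>i\<in>I. X i \<omega> * f2 i \<theta>)"
  define J where "J = (\<lambda>\<omega> n. {k\<in>{..<n}. G \<omega> (real k * T / real n) * G \<omega> (real (Suc k) * T / real n) < 0})"
  define S where "S = (\<lambda>n \<omega>. of_nat (card (J \<omega> n)) :: ennreal)"
  define \<tau> where "\<tau> = (\<lambda>n. sqrt ((A1 / R (T / real n))\<^sup>2 - 1))"
  have derF: "(F \<omega> has_real_derivative G \<omega> \<theta>) (at \<theta>)" for \<omega> \<theta>
    unfolding F_def G_def by (intro DERIV_sum DERIV_cmult der)
  have derG: "(G \<omega> has_real_derivative G' \<omega> \<theta>) (at \<theta>)" for \<omega> \<theta>
    unfolding G'_def G_def by (intro DERIV_sum DERIV_cmult der)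
  have [measurable]: "(\<lambda>\<omega>. F \<omega> \<theta>) \<in> borel_measurable M" "(\<lambda>\<omega>. G \<omega> \<theta>) \<in> borel_measurable M" for \<theta>
    unfolding F_def G_def by (rule measurable_combination)+
  have N: "N = (\<lambda>\<omega>. emeasure (count_space UNIV) {\<theta>\<in>{0..<T}. G \<omega> \<theta> = 0 \<and> F \<omega> \<theta> \<noteq> 0})"
    by (simp add: N_def F_def G_def)
  show meas: "N \<in> borel_measurable M"
    unfolding N
  proof (rule borel_measurable_count[OF T], rule sets_hits_zero_nonzero)
    show "continuous_on UNIV (F \<omega>)" "continuous_on UNIV (G \<omega>)" for \<omega>
      using derF derG by (meson DERIV_isCont continuous_at_imp_continuous_on)+
  qed measurable
  have S_eq: "S n \<omega> = (\<Sum>k<n. indicator {\<omega>\<in>space M. G \<omega> (real k * T / real n) * G \<omega> (real (Suc k) * T / real n) < 0} \<omega>)"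
    if "\<omega> \<in> space M" for n \<omega>
  proof -
    have "S n \<omega> = (\<Sum>k<n. if G \<omega> (real k * T / real n) * G \<omega> (real (Suc k) * T / real n) < 0 then 1 else 0)"
      unfolding S_def J_def by (simp flip: sum.inter_filter)
    also have "\<dots> = (\<Sum>k<n. indicator {\<omega>\<in>space M. G \<omega> (real k * T / real n) * G \<omega> (real (Suc k) * T / real n) < 0} \<omega>)"
      using that by (intro sum.cong) (auto simp: indicator_def)
    finally show ?thesis .
  qed
  have S_meas[measurable]: "S n \<in> borel_measurable M" for n
    by (subst measurable_cong[OF S_eq]) auto
  have ES: "(\<integral>\<^sup>+\<omega>. S n \<omega> \<partial>M)
      = (\<Sum>k<n. emeasure M {\<omega>\<in>space M. G \<omega> (real k * T / real n) * G \<omega> (real (Suc k) * T / real n) < 0})" for n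
  proof -
    have "(\<integral>\<^sup>+\<omega>. S n \<omega> \<partial>M) = (\<integral>\<^sup>+\<omega>. (\<Sum>k<n. indicator
        {\<omega>\<in>space M. G \<omega> (real k * T / real n) * G \<omega> (real (Suc k) * T / real n) < 0} \<omega>) \<partial>M)"
      by (intro nn_integral_cong S_eq)
    also have "\<dots> = (\<Sum>k<n. emeasure M {\<omega>\<in>space M. G \<omega> (real k * T / real n) * G \<omega> (real (Suc k) * T / real n) < 0})"
      by (subst nn_integral_sum) (auto intro!: sum.cong nn_integral_indicator)
    finally show ?thesis .
  qed
  have step: "real k * T / real n + T / real n = real (Suc k) * T / real n" for k n
    by (simp add: distrib_right add_divide_distrib)
  have bounds: "(\<integral>\<^sup>+\<omega>. S n \<omega> \<partial>M) \<le> ennreal (real n * \<tau> n / pi)"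
      "ennreal (real n * \<tau> n / (pi * (1 + (\<tau> n)\<^sup>2))) \<le> (\<integral>\<^sup>+\<omega>. S n \<omega> \<partial>M)"
    if "0 < R (T / real n)" for n
  proof -
    have \<tau>: "0 \<le> \<tau> n"
    proof -
      \<comment> \<open>Cauchy-Schwarz for vectors of equal norm, from the square of their
        difference. It makes the radicand in \<open>\<tau> n\<close> nonnegative; the root of a
        negative number would be negative here.\<close>
      have "R (T / real n) \<le> A1"
      proof -
        have "0 \<le> (\<Sum>i\<in>I. (f1 i 0 - f1 i (0 + T / real n))\<^sup>2)"
          by (intro sum_nonneg) simp
        also have "\<dots> = 2 * (A1 - R (T / real n))"
          using gram(2)[of 0] gram(2)[of "0 + T / real n"] cov[of 0 "T / real n"]
          by (simp add: power2_diff sum.distrib sum_subtractf sum_distrib_left[symmetric] mult.assoc)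
        finally show ?thesis
          by simp
      qed
      then have "1 \<le> (A1 / R (T / real n))\<^sup>2"
        using that by (intro one_le_power) simp
      then show ?thesis
        by (simp add: \<tau>_def)
    qed
    have P: "emeasure M {\<omega>\<in>space M. G \<omega> (real k * T / real n) * G \<omega> (real (Suc k) * T / real n) < 0} \<le> ennreal (\<tau> n / pi)"
      "ennreal (\<tau> n / (pi * (1 + (\<tau> n)\<^sup>2)))
        \<le> emeasure M {\<omega>\<in>space M. G \<omega> (real k * T / real n) * G \<omega> (real (Suc k) * T / real n) < 0}" for k
      unfolding G_def \<tau>_def
      using emeasure_sign_change[OF A(2) that gram(2) _ gram(2), of "real k * T / real n" "real (Suc k) * T / real n"]
        cov[of "real k * T / real n" "T / real n"] step[of k n]
      by simp_all
    have "(\<integral>\<^sup>+\<omega>. S n \<omega> \<partial>M) \<le> (\<Sum>k<n. ennreal (\<tau> n / pi))"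
      unfolding ES by (intro sum_mono P)
    also have "\<dots> = ennreal (real n * \<tau> n / pi)"
      using \<tau> by (subst sum_ennreal) auto
    finally show "(\<integral>\<^sup>+\<omega>. S n \<omega> \<partial>M) \<le> ennreal (real n * \<tau> n / pi)" .
    have "ennreal (real n * \<tau> n / (pi * (1 + (\<tau> n)\<^sup>2))) = (\<Sum>k<n. ennreal (\<tau> n / (pi * (1 + (\<tau> n)\<^sup>2))))"
      using \<tau> by (subst sum_ennreal) (auto intro!: divide_nonneg_nonneg)
    also have "\<dots> \<le> (\<integral>\<^sup>+\<omega>. S n \<omega> \<partial>M)"
      unfolding ES by (intro sum_mono P)
    finally show "ennreal (real n * \<tau> n / (pi * (1 + (\<tau> n)\<^sup>2))) \<le> (\<integral>\<^sup>+\<omega>. S n \<omega> \<partial>M)" .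
  qed
  have lim': "(\<lambda>n. real n * \<tau> n) \<longlonglongrightarrow> pi * L"
    using lim by (simp add: \<tau>_def)
  \<comment> \<open>Convergence of n \<tau> n forces \<tau> n to 0, so the correction 1 + \<tau>^2
    disappears and the two bounds share their limit.\<close>
  have "(\<lambda>n. 1 / real n) \<longlonglongrightarrow> 0"
    by real_asymp
  from tendsto_mult[OF lim' this] have "(\<lambda>n. real n * \<tau> n * (1 / real n)) \<longlonglongrightarrow> 0"
    by simp
  then have \<tau>_lim: "\<tau> \<longlonglongrightarrow> 0"
  proof (rule Lim_transform_eventually)
    show "\<forall>\<^sub>F n in sequentially. real n * \<tau> n * (1 / real n) = \<tau> n"
      using eventually_gt_at_top[of 0] by eventually_elim simp
  qed
  have "(\<lambda>n. pi * (1 + (\<tau> n)\<^sup>2)) \<longlonglongrightarrow> pi * (1 + 0\<^sup>2)"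
    by (intro tendsto_intros \<tau>_lim)
  from tendsto_divide[OF lim' this]
  have lower: "(\<lambda>n. ennreal (real n * \<tau> n / (pi * (1 + (\<tau> n)\<^sup>2)))) \<longlonglongrightarrow> ennreal L"
    by (intro tendsto_ennrealI) simp
  from tendsto_divide[OF lim' tendsto_const[of pi]]
  have upper: "(\<lambda>n. ennreal (real n * \<tau> n / pi)) \<longlonglongrightarrow> ennreal L"
    by (intro tendsto_ennrealI) simp
  have cont2: "continuous_on UNIV (f2 i)" if "i \<in> I" for i
    using der(3)[OF that] by (meson DERIV_isCont continuous_at_imp_continuous_on)
  \<comment> \<open>\<open>1\<close> makes the condition \<open>F \<noteq> 0\<close> automatic at
    the zeros of \<open>G\<close>, \<open>2\<close> makes these zeros simple, and \<open>3\<close>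
    keeps them off the countably many grid points.\<close>
  have 1: "AE \<omega> in M. \<forall>\<theta>\<in>{0..T}. \<not> (F \<omega> \<theta> = 0 \<and> G \<omega> \<theta> = 0)"
    unfolding F_def G_def by (rule AE_no_double_zero[OF T der(1,2) cont2 A(1,2) gram(1,4,2)])
  have 2: "AE \<omega> in M. \<forall>\<theta>\<in>{0..T}. \<not> (G \<omega> \<theta> = 0 \<and> G' \<omega> \<theta> = 0)"
    unfolding G'_def G_def by (rule AE_no_double_zero[OF T der(2,3) cont A(2,3) gram(2,5,3)])
  have 3: "AE \<omega> in M. \<forall>n k. G \<omega> (real k * T / real n) \<noteq> 0"
    unfolding AE_all_countable G_def by (intro allI AE_combination_nonzero[OF A(2,3) gram(2,5,3)])
  have AE: "AE \<omega> in M. (\<forall>n>0. S n \<omega> \<le> N \<omega>) \<and> N \<omega> = liminf (\<lambda>n. S n \<omega>)"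
    using 1 2 3
  proof eventually_elim
    case (elim \<omega>)
    have "N \<omega> = emeasure (count_space UNIV) {\<theta>\<in>{0..<T}. G \<omega> \<theta> = 0}"
      unfolding N using elim(1) by (intro arg_cong[where f = "emeasure (count_space UNIV)"]) force
    moreover note count_zeros_eq_liminf_sign_changes[OF T derG, of \<omega>] elim
    ultimately show ?case
      unfolding S_def J_def by auto
  qed
  have "(\<integral>\<^sup>+\<omega>. N \<omega> \<partial>M) = (\<integral>\<^sup>+\<omega>. liminf (\<lambda>n. S n \<omega>) \<partial>M)"
    using AE by (intro nn_integral_cong_AE) auto
  also have "\<dots> \<le> liminf (\<lambda>n. \<integral>\<^sup>+\<omega>. S n \<omega> \<partial>M)"
    by (rule nn_integral_liminf) measurable
  also have "\<dots> \<le> liminf (\<lambda>n. ennreal (real n * \<tau> n / pi))"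
    using R_pos by (intro Liminf_mono) (auto elim!: eventually_mono intro: bounds)
  also have "\<dots> = ennreal L"
    using upper by (rule lim_imp_Liminf[OF sequentially_bot])
  finally have "(\<integral>\<^sup>+\<omega>. N \<omega> \<partial>M) \<le> ennreal L" .
  \<comment> \<open>The domination of \<open>S n\<close> by \<open>N\<close> supplies the inequality
    that Fatou does not: lower bounds on the mean of \<open>S n\<close> pass to
    \<open>N\<close>.\<close>
  moreover have "ennreal L \<le> (\<integral>\<^sup>+\<omega>. N \<omega> \<partial>M)"
  proof (rule tendsto_upperbound[OF lower])
    show "\<forall>\<^sub>F n in sequentially. ennreal (real n * \<tau> n / (pi * (1 + (\<tau> n)\<^sup>2))) \<le> (\<integral>\<^sup>+\<omega>. N \<omega> \<partial>M)"
      using R_pos eventually_gt_at_top[of 0]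
    proof eventually_elim
      case (elim n)
      have "(\<integral>\<^sup>+\<omega>. S n \<omega> \<partial>M) \<le> (\<integral>\<^sup>+\<omega>. N \<omega> \<partial>M)"
        using AE elim(2) by (intro nn_integral_mono_AE) auto
      with bounds(2)[OF elim(1)] show ?case
        by (rule order_trans)
    qed
  qed simp
  ultimately show "(\<integral>\<^sup>+\<omega>. N \<omega> \<partial>M) = ennreal L"
    by (rule antisym)
qed

end

section \<open>Powers of linear forms on the circle\<close>

text \<open>The n-th derivative of cos^a sin^b as a recursion on the exponents. Truncation of
  \<open>b - 1\<close> or \<open>a - 1\<close> at 0 is harmless, since the coefficient in front is
  then 0.\<close>

primrec trig :: "nat \<Rightarrow> nat \<Rightarrow> nat \<Rightarrow> real \<Rightarrow> real"
  where "trig 0 = (\<lambda>a b \<theta>. cos \<theta> ^ a * sin \<theta> ^ b)"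
  | "trig (Suc n) = (\<lambda>a b \<theta>. real b * trig n (Suc a) (b - 1) \<theta> - real a * trig n (a - 1) (Suc b) \<theta>)"

lemma DERIV_trig: "(trig n a b has_real_derivative trig (Suc n) a b \<theta>) (at \<theta>)"
proof (induction n arbitrary: a b)
  case 0
  show ?case
  proof -
    have "((\<lambda>\<theta>. cos \<theta> ^ a * sin \<theta> ^ b) has_real_derivative
        real b * (cos \<theta> ^ Suc a * sin \<theta> ^ (b - 1)) - real a * (cos \<theta> ^ (a - 1) * sin \<theta> ^ Suc b)) (at \<theta>)"
      by (rule DERIV_mult[OF DERIV_power[OF DERIV_cos] DERIV_power[OF DERIV_sin], THEN DERIV_cong])
        (simp add: algebra_simps)
    then show ?thesis
      by simp
  qed
next
  case (Suc n)
  have "((\<lambda>\<theta>. real b * trig n (Suc a) (b - 1) \<theta> - real a * trig n (a - 1) (Suc b) \<theta>) has_real_derivative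
      real b * trig (Suc n) (Suc a) (b - 1) \<theta> - real a * trig (Suc n) (a - 1) (Suc b) \<theta>) (at \<theta>)"
    by (intro DERIV_diff DERIV_cmult Suc.IH)
  then show ?case
    by simp
qed

text \<open>These are derivatives at 0 of the covariance function cos^p. Up to sign, the even ones
  are the variances of the process and of its first two derivatives, and the odd ones are the
  covariances of consecutive derivatives.\<close>

lemma trig_at_zero:
  assumes "1 \<le> p"
  shows "trig 0 p 0 0 = 1" "trig 1 p 0 0 = 0" "trig 2 p 0 0 = - real p" "trig 3 p 0 0 = 0"
    "trig 4 p 0 0 = real p * (3 * real p - 2)"
proof -
  show "trig 0 p 0 0 = 1" "trig 1 p 0 0 = 0"
    by simp_all
  show "trig 2 p 0 0 = - real p" "trig 3 p 0 0 = 0"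
    by (simp_all add: numeral_eq_Suc)
  show "trig 4 p 0 0 = real p * (3 * real p - 2)"
    using assms by (simp add: numeral_eq_Suc of_nat_diff algebra_simps)
qed

text \<open>For f homogeneous of degree p, the n-th \<theta>-derivative of the value of f at (cos
  \<theta>, sin \<theta>). The explicit sum over coefficients makes linearity in f immediate for
  every n.\<close>

definition angular :: "nat \<Rightarrow> nat \<Rightarrow> poly2 \<Rightarrow> real \<Rightarrow> real"
  where "angular p n f \<theta> = (\<Sum>a\<le>p. Poly_Mapping.lookup f (a, p - a) * trig n a (p - a) \<theta>)"

lemma DERIV_angular: "(angular p n f has_real_derivative angular p (Suc n) f \<theta>) (at \<theta>)"
  unfolding angular_def by (intro DERIV_sum DERIV_cmult DERIV_trig)

definition circle :: "real \<Rightarrow> poly2"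
  where "circle \<theta> = const2 (cos \<theta>) * e\<^sub>1 + const2 (sin \<theta>) * e\<^sub>2"

lemma lookup_const2_mult [simp]: "Poly_Mapping.lookup (const2 c * f) \<alpha> = c * Poly_Mapping.lookup f \<alpha>"
proof -
  have "const2 c * f = Poly_Mapping.map ((*) c) f"
    by (simp add: mult_map_scale_conv_mult const2_def zero_prod_def)
  then show ?thesis
    by (simp add: map.rep_eq when_def)
qed

lemma const2_mult: "const2 (c * d) = const2 c * const2 d"
  by (simp add: const2_def mult_single)

lemma const2_power: "const2 c ^ n = const2 (c ^ n)"
  by (induction n) (simp_all add: const2_mult, simp add: const2_def flip: zero_prod_def)

lemma const2_minus: "const2 (- c) = - const2 c"
  by (simp add: const2_def single_uminus)

lemma single_power: "Poly_Mapping.single (\<alpha> :: nat \<times> nat) (x :: real) ^ k = Poly_Mapping.single (k * fst \<alpha>, k * snd \<alpha>) (x ^ k)"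
  by (induction k) (simp_all add: mult_single plus_prod_def flip: zero_prod_def)

lemma linear_power:
  "(const2 x * e\<^sub>1 + const2 y * e\<^sub>2) ^ p
    = (\<Sum>a\<le>p. Poly_Mapping.single (a, p - a) (real (p choose a) * x ^ a * y ^ (p - a)))"
proof -
  have "const2 x * e\<^sub>1 = Poly_Mapping.single (1, 0) x" "const2 y * e\<^sub>2 = Poly_Mapping.single (0, 1) y"
    by (simp_all add: const2_def e\<^sub>1_def e\<^sub>2_def mult_single)
  moreover have "of_nat (p choose a) = Poly_Mapping.single ((0, 0) :: nat \<times> nat) (real (p choose a))" for a
    by (simp flip: zero_prod_def)
  ultimately show ?thesis
    by (simp add: binomial_ring single_power mult_single)
qed

lemma lookup_sum_single:
  fixes p :: nat
  shows "Poly_Mapping.lookup (\<Sum>a\<le>p. Poly_Mapping.single (a, p - a) (c a :: real)) (i, j) = (if i + j = p then c i else 0)"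
proof -
  have "Poly_Mapping.lookup (\<Sum>a\<le>p. Poly_Mapping.single (a, p - a) (c a)) (i, j)
      = (\<Sum>a\<le>p. if a = i then (if i + j = p then c i else 0) else 0)"
    unfolding lookup_sum by (intro sum.cong) (auto simp: lookup_single when_def)
  also have "\<dots> = (if i + j = p then c i else 0)"
    by simp
  finally show ?thesis .
qed

lemma lookup_circle_power:
  "Poly_Mapping.lookup (circle \<theta> ^ p) (i, j) = (if i + j = p then real (p choose i) * trig 0 i j \<theta> else 0)"
  unfolding circle_def linear_power lookup_sum_single by auto

lemma homogeneous_iff: "f \<in> homogeneous_polys p \<longleftrightarrow> (\<forall>i j. i + j \<noteq> p \<longrightarrow> Poly_Mapping.lookup f (i, j) = 0)"
  by (auto simp: homogeneous_polys_def in_keys_iff)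

lemma homogeneous_circle_power: "circle \<theta> ^ p \<in> homogeneous_polys p"
  by (simp add: homogeneous_iff lookup_circle_power)

lemma bombieri_inner_alt:
  "bombieri_inner p f g
    = (\<Sum>a\<le>p. Poly_Mapping.lookup f (a, p - a) * (Poly_Mapping.lookup g (a, p - a) / real (p choose a)))"
proof -
  have "{(a, b). a + b = p} = (\<lambda>a. (a, p - a)) ` {..p}"
    by force
  moreover have "inj_on (\<lambda>a. (a, p - a)) {..p}"
    by (auto intro: inj_onI)
  ultimately have "bombieri_inner p f g = (\<Sum>a\<le>p. fact a * fact (p - a) / fact p *
      Poly_Mapping.lookup f (a, p - a) * Poly_Mapping.lookup g (a, p - a))"
    by (simp add: bombieri_inner_def sum.reindex)
  also have "\<dots> = (\<Sum>a\<le>p. Poly_Mapping.lookup f (a, p - a) * (Poly_Mapping.lookup g (a, p - a) / real (p choose a)))"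
    by (intro sum.cong) (simp_all add: binomial_fact)
  finally show ?thesis .
qed

lemma bombieri_inner_commute: "bombieri_inner p f g = bombieri_inner p g f"
  by (simp add: bombieri_inner_alt mult_ac)

lemma bombieri_inner_const2_right: "bombieri_inner p f (const2 c * g) = c * bombieri_inner p f g"
  by (simp add: bombieri_inner_alt) (simp add: sum_distrib_left mult_ac)

lemma bombieri_inner_sum_right:
  "bombieri_inner p f (\<Sum>i\<in>A. const2 (c i) * g i) = (\<Sum>i\<in>A. c i * bombieri_inner p f (g i))"
  by (simp add: bombieri_inner_alt lookup_sum)
    (simp add: sum_distrib_left sum_distrib_right sum_divide_distrib mult_ac sum.swap[of _ A])

text \<open>Reproducing property: the binomial coefficients in the power of a linear form cancel the
  Bombieri weights 1 / (p choose a), which leaves evaluation on the circle.\<close>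

lemma bombieri_inner_circle_power: "bombieri_inner p f (circle \<theta> ^ p) = angular p 0 f \<theta>"
  unfolding bombieri_inner_alt angular_def lookup_circle_power by (intro sum.cong) auto

lemma angular_minus: "angular p n (f - g) \<theta> = angular p n f \<theta> - angular p n g \<theta>"
  by (simp add: angular_def lookup_minus left_diff_distrib sum_subtractf)

lemma angular_const2_mult: "angular p n (const2 c * f) \<theta> = c * angular p n f \<theta>"
  by (simp add: angular_def) (simp add: sum_distrib_left mult_ac)

text \<open>For n = 0 this is the binomial theorem for the p-th power of cos \<phi> cos \<theta> +
  sin \<phi> sin \<theta>. Higher orders follow because both sides are successive
  \<theta>-derivatives and derivatives are unique.\<close>

lemma angular_circle_power: "angular p n (circle \<phi> ^ p) \<theta> = trig n p 0 (\<theta> - \<phi>)"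
proof (induction n arbitrary: \<theta>)
  case 0
  have "trig 0 p 0 (\<theta> - \<phi>) = (cos \<phi> * cos \<theta> + sin \<phi> * sin \<theta>) ^ p"
    by (simp add: cos_diff mult.commute)
  also have "\<dots> = (\<Sum>a\<le>p. real (p choose a) * (cos \<phi> * cos \<theta>) ^ a * (sin \<phi> * sin \<theta>) ^ (p - a))"
    by (rule binomial_ring)
  also have "\<dots> = angular p 0 (circle \<phi> ^ p) \<theta>"
    by (auto simp: angular_def lookup_circle_power power_mult_distrib mult_ac intro!: sum.cong)
  finally show ?case ..
next
  case (Suc n)
  have "((\<lambda>\<theta>. trig n p 0 (\<theta> - \<phi>)) has_real_derivative trig (Suc n) p 0 (\<theta> - \<phi>) * (1 - 0)) (at \<theta>)"
    by (rule DERIV_chain2[OF DERIV_trig]) (auto intro!: derivative_eq_intros)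
  moreover have "((\<lambda>\<theta>. trig n p 0 (\<theta> - \<phi>)) has_real_derivative angular p (Suc n) (circle \<phi> ^ p) \<theta>) (at \<theta>)"
    using DERIV_angular[of p n "circle \<phi> ^ p" \<theta>] by (simp only: Suc.IH[abs_def])
  ultimately show ?case
    using DERIV_unique by fastforce
qed

section \<open>Orthonormal bases and the covariance of the process\<close>

lemma parseval:
  assumes b: "bombieri_orthonormal_basis p b" and f: "f \<in> homogeneous_polys p"
  shows "(\<Sum>i\<le>p. bombieri_inner p f (b i) * bombieri_inner p g (b i)) = bombieri_inner p g f"
proof -
  obtain c where c: "f = (\<Sum>i\<le>p. const2 (c i) * b i)"
    using b f unfolding bombieri_orthonormal_basis_def by blast
  have "bombieri_inner p f (b i) = c i" if "i \<le> p" for i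
  proof -
    have "bombieri_inner p f (b i) = (\<Sum>j\<le>p. c j * bombieri_inner p (b i) (b j))"
      unfolding c by (subst bombieri_inner_commute) (rule bombieri_inner_sum_right)
    also have "\<dots> = (\<Sum>j\<le>p. if i = j then c j else 0)"
      using b that unfolding bombieri_orthonormal_basis_def by (intro sum.cong) auto
    also have "\<dots> = c i"
      using that by simp
    finally show ?thesis .
  qed
  then have "(\<Sum>i\<le>p. bombieri_inner p f (b i) * bombieri_inner p g (b i)) = (\<Sum>i\<le>p. c i * bombieri_inner p g (b i))"
    by (intro sum.cong) auto
  also have "\<dots> = bombieri_inner p g f"
    unfolding c by (rule bombieri_inner_sum_right[symmetric])
  finally show ?thesis .
qed

text \<open>At order (0, 0) Parseval and the reproducing property give cos^p(\<theta> - \<phi>),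
  whatever the basis. The identity is then differentiated n times in \<theta> and m times in \<phi>,
  and each \<phi>-derivative contributes a factor -1.\<close>

lemma covariance_angular:
  assumes b: "bombieri_orthonormal_basis p b"
  shows "(\<Sum>i\<le>p. angular p n (b i) \<theta> * angular p m (b i) \<phi>) = (- 1) ^ m * trig (n + m) p 0 (\<theta> - \<phi>)"
proof (induction m arbitrary: \<phi>)
  case 0
  show ?case
  proof (induction n arbitrary: \<theta>)
    case 0
    show ?case
      using parseval[OF b homogeneous_circle_power[of \<theta>], of "circle \<phi> ^ p"]
      by (simp add: bombieri_inner_circle_power angular_circle_power bombieri_inner_commute[of p "circle _ ^ p"]
          del: trig.simps)
  next
    case (Suc n)
    have "((\<lambda>\<theta>. trig n p 0 (\<theta> - \<phi>)) has_real_derivative trig (Suc n) p 0 (\<theta> - \<phi>) * (1 - 0)) (at \<theta>)"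
      by (rule DERIV_chain2[OF DERIV_trig]) (auto intro!: derivative_eq_intros)
    moreover have "((\<lambda>\<theta>. \<Sum>i\<le>p. angular p n (b i) \<theta> * angular p 0 (b i) \<phi>) has_real_derivative
        (\<Sum>i\<le>p. angular p (Suc n) (b i) \<theta> * angular p 0 (b i) \<phi>)) (at \<theta>)"
      by (intro DERIV_sum DERIV_cmult_right DERIV_angular)
    ultimately show ?case
      using DERIV_unique by (fastforce simp: Suc.IH simp del: trig.simps)
  qed
next
  case (Suc m)
  have "((\<lambda>\<phi>. (- 1) ^ m * trig (n + m) p 0 (\<theta> - \<phi>)) has_real_derivative
      (- 1) ^ m * (trig (Suc (n + m)) p 0 (\<theta> - \<phi>) * (0 - 1))) (at \<phi>)"
    by (intro DERIV_cmult DERIV_chain2[OF DERIV_trig]) (auto intro!: derivative_eq_intros)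
  moreover have "((\<lambda>\<phi>. \<Sum>i\<le>p. angular p n (b i) \<theta> * angular p m (b i) \<phi>) has_real_derivative
      (\<Sum>i\<le>p. angular p n (b i) \<theta> * angular p (Suc m) (b i) \<phi>)) (at \<phi>)"
    by (intro DERIV_sum DERIV_cmult DERIV_angular)
  ultimately show ?case
    using DERIV_unique by (fastforce simp: Suc.IH simp del: trig.simps)
qed

text \<open>\<open>R \<delta>\<close> is the covariance of \<open>F'\<close> at lag \<delta>, that
  is p h(\<delta>) with h = 1 - (3p - 2) \<delta>^2 / 2 + o(\<delta>^2). The tangent of the
  correlation angle is therefore asymptotic to sqrt(3p - 2) \<delta>, and n \<delta> = pi.\<close>

lemma curvature_limit:
  assumes p: "1 \<le> p"
  defines "R \<equiv> \<lambda>\<delta>. - trig 2 p 0 (- \<delta>)"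
  shows "\<forall>\<^sub>F n in sequentially. 0 < R (pi / real n)"
    and "(\<lambda>n. real n * sqrt ((real p / R (pi / real n))\<^sup>2 - 1)) \<longlonglongrightarrow> pi * sqrt (3 * real p - 2)"
proof -
  \<comment> \<open>For p = 1 the truncated exponent p - 2 does no harm, thanks to the factor p -
    1.\<close>
  define h where "h = (\<lambda>x. cos x ^ p - (real p - 1) * (cos x ^ (p - 2) * (sin x)\<^sup>2))"
  have R: "R x = real p * h x" for x
    using p by (simp add: R_def h_def numeral_eq_Suc of_nat_diff algebra_simps diff_Suc split: nat.splits)
  define \<delta> where "\<delta> = (\<lambda>n. pi / real n)"
  have c: "(\<lambda>n. cos (\<delta> n)) \<longlonglongrightarrow> 1" and s: "(\<lambda>n. (sin (\<delta> n) / \<delta> n)\<^sup>2) \<longlonglongrightarrow> 1"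
    unfolding \<delta>_def by real_asymp+
  have "filterlim \<delta> (at_right 0) sequentially"
    unfolding \<delta>_def by real_asymp
  moreover have "((\<lambda>x::real. (1 - cos x) / x\<^sup>2) \<longlongrightarrow> 1 / 2) (at_right 0)"
    by real_asymp
  ultimately have q: "(\<lambda>n. (1 - cos (\<delta> n)) / (\<delta> n)\<^sup>2) \<longlonglongrightarrow> 1 / 2"
    by (rule filterlim_compose[rotated])
  have h1: "(\<lambda>n. h (\<delta> n)) \<longlonglongrightarrow> 1"
  proof -
    have "(\<lambda>n. sin (\<delta> n)) \<longlonglongrightarrow> 0"
      unfolding \<delta>_def by real_asymp
    then have "(\<lambda>n. h (\<delta> n)) \<longlonglongrightarrow> 1 ^ p - (real p - 1) * (1 ^ (p - 2) * 0\<^sup>2)"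
      unfolding h_def by (intro tendsto_intros c)
    then show ?thesis
      by simp
  qed
  have h2: "(\<lambda>n. (1 - h (\<delta> n)) / (\<delta> n)\<^sup>2) \<longlonglongrightarrow> (3 * real p - 2) / 2"
  proof -
    \<comment> \<open>Factoring 1 - cos^p through the geometric sum copes with symbolic p; the two
      summands tend to p / 2 and p - 1.\<close>
    have "(1 - h x) / x\<^sup>2 = (1 - cos x) / x\<^sup>2 * (\<Sum>j<p. cos x ^ j) + (real p - 1) * cos x ^ (p - 2) * (sin x / x)\<^sup>2" for x
    proof -
      have "1 - h x = (1 - cos x) * (\<Sum>j<p. cos x ^ j) + (real p - 1) * cos x ^ (p - 2) * (sin x)\<^sup>2"
        unfolding h_def one_diff_power_eq[symmetric] by simp
      then show ?thesis
        by (simp add: power_divide add_divide_distrib)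
    qed
    moreover have "(\<lambda>n. (1 - cos (\<delta> n)) / (\<delta> n)\<^sup>2 * (\<Sum>j<p. cos (\<delta> n) ^ j) + (real p - 1) * cos (\<delta> n) ^ (p - 2) * (sin (\<delta> n) / \<delta> n)\<^sup>2)
        \<longlonglongrightarrow> 1 / 2 * (\<Sum>j<p. 1 ^ j) + (real p - 1) * 1 ^ (p - 2) * 1"
      by (intro tendsto_intros c s q)
    ultimately show ?thesis
      by (simp add: field_simps)
  qed
  have ev: "\<forall>\<^sub>F n in sequentially. 0 < h (\<delta> n)"
    using h1 by (rule order_tendstoD) simp
  then show "\<forall>\<^sub>F n in sequentially. 0 < R (pi / real n)"
    using p unfolding R \<delta>_def by (auto elim: eventually_mono)
  \<comment> \<open>The expression under the root comes from 1 / h^2 - 1 = (1 - h)(1 + h) / h^2,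
    with n = pi / \<delta> providing the division by \<delta>^2; the limit 2 of 1 + h cancels the
    1/2.\<close>
  have "(\<lambda>n. pi * sqrt ((1 - h (\<delta> n)) / (\<delta> n)\<^sup>2 * (1 + h (\<delta> n)) / (h (\<delta> n))\<^sup>2))
      \<longlonglongrightarrow> pi * sqrt ((3 * real p - 2) / 2 * (1 + 1) / 1\<^sup>2)"
    by (intro tendsto_intros h1 h2) simp
  also have "(3 * real p - 2) / 2 * (1 + 1) / 1\<^sup>2 = 3 * real p - 2"
    by simp
  finally show "(\<lambda>n. real n * sqrt ((real p / R (pi / real n))\<^sup>2 - 1)) \<longlonglongrightarrow> pi * sqrt (3 * real p - 2)"
  proof (rule Lim_transform_eventually)
    show "\<forall>\<^sub>F n in sequentially. pi * sqrt ((1 - h (\<delta> n)) / (\<delta> n)\<^sup>2 * (1 + h (\<delta> n)) / (h (\<delta> n))\<^sup>2)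
      = real n * sqrt ((real p / R (pi / real n))\<^sup>2 - 1)"
    using ev eventually_gt_at_top[of 0]
  proof eventually_elim
    case (elim n)
    have d: "0 < \<delta> n" "pi / \<delta> n = real n"
      using elim by (auto simp: \<delta>_def)
    have "(1 - h (\<delta> n)) / (\<delta> n)\<^sup>2 * (1 + h (\<delta> n)) / (h (\<delta> n))\<^sup>2 = (1 - (h (\<delta> n))\<^sup>2) / (h (\<delta> n))\<^sup>2 / (\<delta> n)\<^sup>2"
      by (simp add: power2_eq_square algebra_simps)
    also have "(1 - (h (\<delta> n))\<^sup>2) / (h (\<delta> n))\<^sup>2 = (1 / h (\<delta> n))\<^sup>2 - 1"
      using elim(1) by (simp add: diff_divide_distrib power_divide)
    also have "1 / h (\<delta> n) = real p / R (pi / real n)"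
      using p by (simp add: R \<delta>_def)
    finally show ?case
      using d by (simp add: real_sqrt_divide) (metis times_divide_eq_left times_divide_eq_right)
  qed
  qed
qed

section \<open>Critical points\<close>

lemma const2_circle: "const2 (r * cos \<theta>) * e\<^sub>1 + const2 (r * sin \<theta>) * e\<^sub>2 = const2 r * circle \<theta>"
  by (simp add: circle_def const2_mult distrib_left mult.assoc)

text \<open>With a radius of either sign, half a turn of angles covers the plane. The start
  \<open>\<theta>\<^sub>0\<close> is free because the count uses [0, pi), whereas the study of
  curves needs a window centred at a given angle.\<close>

lemma polar_half_turn:
  fixes t\<^sub>1 t\<^sub>2 \<theta>\<^sub>0 :: real
  obtains r \<theta> where "\<theta> \<in> {\<theta>\<^sub>0..<\<theta>\<^sub>0 + pi}" "t\<^sub>1 = r * cos \<theta>" "t\<^sub>2 = r * sin \<theta>"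
proof (cases "t\<^sub>1 = 0 \<and> t\<^sub>2 = 0")
  case True
  then show ?thesis
    using that[of \<theta>\<^sub>0 0] by simp
next
  case False
  define r where "r = sqrt (t\<^sub>1\<^sup>2 + t\<^sub>2\<^sup>2)"
  have r: "r \<noteq> 0" "r\<^sup>2 = t\<^sub>1\<^sup>2 + t\<^sub>2\<^sup>2"
    using False by (auto simp: r_def sum_power2_eq_zero_iff)
  \<comment> \<open>Coordinates in the frame turned by \<open>\<theta>\<^sub>0\<close>, so that the
    ordinary angle in [0, 2 pi) is measured from there; an angle of at least pi is moved back by pi
    and the radius negated.\<close>
  define u w where "u = (t\<^sub>1 * cos \<theta>\<^sub>0 + t\<^sub>2 * sin \<theta>\<^sub>0) / r" and "w = (t\<^sub>2 * cos \<theta>\<^sub>0 - t\<^sub>1 * sin \<theta>\<^sub>0) / r"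
  have cs: "(cos \<theta>\<^sub>0)\<^sup>2 + (sin \<theta>\<^sub>0)\<^sup>2 = 1"
    by simp
  have "(t\<^sub>1 * cos \<theta>\<^sub>0 + t\<^sub>2 * sin \<theta>\<^sub>0)\<^sup>2 + (t\<^sub>2 * cos \<theta>\<^sub>0 - t\<^sub>1 * sin \<theta>\<^sub>0)\<^sup>2 = r\<^sup>2"
    unfolding r(2) using cs by algebra
  then have "u\<^sup>2 + w\<^sup>2 = 1"
    using r(1) by (simp add: u_def w_def power_divide flip: add_divide_distrib)
  then obtain \<phi> where \<phi>: "0 \<le> \<phi>" "\<phi> < 2 * pi" "u = cos \<phi>" "w = sin \<phi>"
    by (rule sincos_total_2pi)
  have t: "t\<^sub>1 = r * cos (\<theta>\<^sub>0 + \<phi>)" "t\<^sub>2 = r * sin (\<theta>\<^sub>0 + \<phi>)"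
  proof -
    have "r * u = t\<^sub>1 * cos \<theta>\<^sub>0 + t\<^sub>2 * sin \<theta>\<^sub>0" "r * w = t\<^sub>2 * cos \<theta>\<^sub>0 - t\<^sub>1 * sin \<theta>\<^sub>0"
      using r(1) by (simp_all add: u_def w_def)
    then show "t\<^sub>1 = r * cos (\<theta>\<^sub>0 + \<phi>)" "t\<^sub>2 = r * sin (\<theta>\<^sub>0 + \<phi>)"
      using cs unfolding \<phi>(3,4) cos_add sin_add by algebra+
  qed
  show ?thesis
  proof (cases "\<phi> < pi")
    case True
    then show ?thesis
      using that[of "\<theta>\<^sub>0 + \<phi>" r] t \<phi>(1) by simp
  next
    case False
    have "cos (\<theta>\<^sub>0 + \<phi> - pi) = - cos (\<theta>\<^sub>0 + \<phi>)" "sin (\<theta>\<^sub>0 + \<phi> - pi) = - sin (\<theta>\<^sub>0 + \<phi>)"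
      by (simp_all add: cos_diff sin_diff)
    then show ?thesis
      using that[of "\<theta>\<^sub>0 + \<phi> - pi" "- r"] t \<phi>(2) False by simp
  qed
qed

lemma signed_powersE:
  assumes "x \<in> signed_powers p"
  obtains s \<theta> where "s \<noteq> 0" "\<theta> \<in> {\<theta>\<^sub>0..<\<theta>\<^sub>0 + pi}" "x = const2 s * circle \<theta> ^ p"
proof -
  obtain t\<^sub>1 t\<^sub>2 where x: "x \<noteq> 0" "x = (const2 t\<^sub>1 * e\<^sub>1 + const2 t\<^sub>2 * e\<^sub>2) ^ p \<or> x = - ((const2 t\<^sub>1 * e\<^sub>1 + const2 t\<^sub>2 * e\<^sub>2) ^ p)"
    using assms by (auto simp: signed_powers_def)
  obtain r \<theta> where \<theta>: "\<theta> \<in> {\<theta>\<^sub>0..<\<theta>\<^sub>0 + pi}" "t\<^sub>1 = r * cos \<theta>" "t\<^sub>2 = r * sin \<theta>"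
    by (rule polar_half_turn)
  have "(const2 t\<^sub>1 * e\<^sub>1 + const2 t\<^sub>2 * e\<^sub>2) ^ p = const2 (r ^ p) * circle \<theta> ^ p"
    by (simp add: \<theta> const2_circle power_mult_distrib const2_power)
  then have "x = const2 (r ^ p) * circle \<theta> ^ p \<or> x = const2 (- (r ^ p)) * circle \<theta> ^ p"
    using x(2) by (simp add: const2_minus)
  then obtain s where s: "x = const2 s * circle \<theta> ^ p"
    by blast
  moreover from this have "s \<noteq> 0"
    using x(1) by (auto simp: const2_def)
  ultimately show ?thesis
    using that \<theta>(1) by blast
qed

text \<open>The radius is a root of |s|, and the sign of s is left to the sign allowed in
  \<open>signed_powers\<close>, since for even p no power of a real radius is negative. The point is
  nonzero because its value at angle \<theta> is s.\<close>

lemma signed_powersI: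
  assumes p: "1 \<le> p" and s: "s \<noteq> 0"
  shows "const2 s * circle \<theta> ^ p \<in> signed_powers p"
proof -
  define r where "r = root p \<bar>s\<bar>"
  have r: "r ^ p = \<bar>s\<bar>"
    using p by (simp add: r_def)
  have pow: "(const2 (r * cos \<theta>) * e\<^sub>1 + const2 (r * sin \<theta>) * e\<^sub>2) ^ p = const2 \<bar>s\<bar> * circle \<theta> ^ p"
    by (simp add: const2_circle power_mult_distrib const2_power r)
  have "const2 s * circle \<theta> ^ p \<noteq> 0"
  proof
    assume "const2 s * circle \<theta> ^ p = 0"
    then have "angular p 0 (const2 s * circle \<theta> ^ p) \<theta> = 0"
      by (simp add: angular_def)
    then show False
      using s by (simp add: angular_const2_mult angular_circle_power)
  qed
  moreover have "const2 s * circle \<theta> ^ p = const2 \<bar>s\<bar> * circle \<theta> ^ p \<or> const2 s * circle \<theta> ^ p = - (const2 \<bar>s\<bar> * circle \<theta> ^ p)"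
    by (cases "0 \<le> s") (simp_all add: const2_minus)
  ultimately show ?thesis
    unfolding signed_powers_def by (auto simp flip: pow)
qed

text \<open>Evaluation a quarter turn away from \<phi> kills the right-hand side, as p \<ge> 1. So
  \<theta> and \<phi> differ by a multiple of pi, and the half-open window leaves only 0.\<close>

lemma const2_circle_power_inj:
  assumes p: "1 \<le> p" and st: "s \<noteq> 0" "t \<noteq> 0" and \<theta>: "\<theta> \<in> {\<theta>\<^sub>0..<\<theta>\<^sub>0 + pi}" "\<phi> \<in> {\<theta>\<^sub>0..<\<theta>\<^sub>0 + pi}"
    and eq: "const2 s * circle \<theta> ^ p = const2 t * circle \<phi> ^ p"
  shows "\<theta> = \<phi>"
proof -
  have "angular p 0 (const2 s * circle \<theta> ^ p) (\<phi> + pi / 2) = 0"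
    using p by (simp add: eq angular_const2_mult angular_circle_power)
  then have "cos (\<phi> + pi / 2 - \<theta>) = 0"
    using st by (simp add: angular_const2_mult angular_circle_power)
  then have "sin (\<theta> - \<phi>) = 0"
    by (simp add: cos_add cos_diff sin_diff sin_add algebra_simps)
  moreover have "- pi < \<theta> - \<phi>" "\<theta> - \<phi> < pi"
    using \<theta> by auto
  ultimately have "\<theta> - \<phi> = 0"
    using sin_eq_0_pi by blast
  then show ?thesis
    by simp
qed

section \<open>Tangent vectors of the cone of signed powers\<close>

lemma funpow_deriv:
  assumes "\<And>n t. (h n has_real_derivative h (Suc n) t) (at t)"
  shows "(deriv ^^ n) (h 0) = h n"
proof (induction n)
  case (Suc n)
  have "deriv (h n) = h (Suc n)"
    using assms by (auto intro: DERIV_imp_deriv)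
  with Suc show ?case
    by simp
qed simp

lemma velocity_in_tangent_space:
  fixes \<gamma> :: "real \<Rightarrow> poly2" and h :: "nat \<times> nat \<Rightarrow> nat \<Rightarrow> real \<Rightarrow> real"
  assumes "0 < \<epsilon>" "\<And>t. t \<in> {-\<epsilon><..<\<epsilon>} \<Longrightarrow> \<gamma> t \<in> X"
    and h: "\<And>\<alpha> n t. (h \<alpha> n has_real_derivative h \<alpha> (Suc n) t) (at t)"
      "\<And>\<alpha> t. Poly_Mapping.lookup (\<gamma> t) \<alpha> = h \<alpha> 0 t" "\<And>\<alpha>. Poly_Mapping.lookup w \<alpha> = h \<alpha> 1 0"
  shows "w \<in> tangent_space X (\<gamma> 0)"
proof -
  have eq: "(\<lambda>s. Poly_Mapping.lookup (\<gamma> s) \<alpha>) = h \<alpha> 0" for \<alpha>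
    using h(2) by auto
  have "(deriv ^^ n) (h \<alpha> 0) differentiable (at t)" for \<alpha> n t
    using funpow_deriv[of "h \<alpha>" n, OF h(1)] h(1)[of \<alpha> n t] by (auto simp: real_differentiable_def)
  moreover have "(h \<alpha> 0 has_real_derivative Poly_Mapping.lookup w \<alpha>) (at 0)" for \<alpha>
    using h(1)[of \<alpha> 0 0] by (simp add: h(3))
  ultimately show ?thesis
    unfolding tangent_space_def mem_Collect_eq eq using assms(1,2) eq
    by (intro exI[of _ \<gamma>] exI[of _ \<epsilon>]) simp
qed

lemma radial_in_tangent_space:
  assumes p: "1 \<le> p" and s: "s \<noteq> 0"
  shows "circle \<theta> ^ p \<in> tangent_space (signed_powers p) (const2 s * circle \<theta> ^ p)"
proof -
  \<comment> \<open>The curve is (s + t) c^p, and the last factor lists the derivatives s + t, 1, 0,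
    ... of its coefficient. For |t| < |s| the coefficient does not vanish, so the curve stays in the
    cone.\<close>
  define h where "h = (\<lambda>\<alpha> (n :: nat) t. Poly_Mapping.lookup (circle \<theta> ^ p) \<alpha> * (if n = 0 then s + t else if n = 1 then 1 else 0 :: real))"
  have "circle \<theta> ^ p \<in> tangent_space (signed_powers p) (const2 (s + 0) * circle \<theta> ^ p)"
  proof (rule velocity_in_tangent_space[where h = h and \<epsilon> = "\<bar>s\<bar>"])
    fix \<alpha> :: "nat \<times> nat" and n and t :: real
    have "((\<lambda>t. if n = 0 then s + t else if n = 1 then 1 else 0) has_real_derivative
        (if Suc n = 0 then s + t else if Suc n = 1 then 1 else 0)) (at t)"
      by (cases n) (auto intro!: derivative_eq_intros)
    then show "(h \<alpha> n has_real_derivative h \<alpha> (Suc n) t) (at t)"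
      unfolding h_def by (rule DERIV_cmult)
    show "Poly_Mapping.lookup (const2 (s + t) * circle \<theta> ^ p) \<alpha> = h \<alpha> 0 t"
      by (simp add: h_def)
    show "Poly_Mapping.lookup (circle \<theta> ^ p) \<alpha> = h \<alpha> 1 0"
      by (simp add: h_def)
  next
    fix t assume "t \<in> {- \<bar>s\<bar><..<\<bar>s\<bar>}"
    then show "const2 (s + t) * circle \<theta> ^ p \<in> signed_powers p"
      using p by (intro signed_powersI) auto
  qed (use s in auto)
  then show ?thesis
    by simp
qed

lemma angular_in_tangent_space:
  assumes p: "1 \<le> p" and s: "s \<noteq> 0"
  obtains w where "w \<in> tangent_space (signed_powers p) (const2 s * circle \<theta> ^ p)"
    "\<And>f. bombieri_inner p f w = s * angular p 1 f \<theta>"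
proof -
  define w where "w = (\<Sum>a\<le>p. Poly_Mapping.single (a, p - a) (s * (real (p choose a) * trig 1 a (p - a) \<theta>)))"
  define h where "h = (\<lambda>(i, j) n t. (if i + j = p then s * (real (p choose i) * trig n i j (\<theta> + t)) else 0))"
  have "w \<in> tangent_space (signed_powers p) (const2 s * circle (\<theta> + 0) ^ p)"
  proof (rule velocity_in_tangent_space[where h = h and \<epsilon> = 1])
    fix \<alpha> :: "nat \<times> nat" and n and t :: real
    obtain i j where \<alpha>: "\<alpha> = (i, j)"
      by fastforce
    have "((\<lambda>t. trig n i j (\<theta> + t)) has_real_derivative trig (Suc n) i j (\<theta> + t) * (0 + 1)) (at t)"
      by (rule DERIV_chain2[OF DERIV_trig]) (auto intro!: derivative_eq_intros)
    then have "((\<lambda>t. s * (real (p choose i) * trig n i j (\<theta> + t))) has_real_derivative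
        s * (real (p choose i) * trig (Suc n) i j (\<theta> + t))) (at t)"
      by (intro DERIV_cmult) (simp del: trig.simps)
    then show "(h \<alpha> n has_real_derivative h \<alpha> (Suc n) t) (at t)"
      by (simp add: h_def \<alpha> del: trig.simps)
    show "Poly_Mapping.lookup (const2 s * circle (\<theta> + t) ^ p) \<alpha> = h \<alpha> 0 t"
      by (simp add: h_def \<alpha> lookup_circle_power)
    show "Poly_Mapping.lookup w \<alpha> = h \<alpha> 1 0"
      by (auto simp: h_def \<alpha> w_def lookup_sum_single simp del: trig.simps)
  next
    fix t :: real
    show "const2 s * circle (\<theta> + t) ^ p \<in> signed_powers p"
      by (rule signed_powersI[OF p s])
  qed simp
  then have "w \<in> tangent_space (signed_powers p) (const2 s * circle \<theta> ^ p)"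
    by simp
  moreover have "bombieri_inner p f w = s * angular p 1 f \<theta>" for f
    unfolding bombieri_inner_alt w_def lookup_sum_single angular_def sum_distrib_left
    by (intro sum.cong) (auto simp del: trig.simps)
  ultimately show ?thesis
    by (rule that)
qed

text \<open>
  A curve in the cone through \<open>s c\<^sup>p\<close>, with \<open>c\<close> the unit vector of angle \<open>\<theta>\<close>, has the form
  \<open>\<sigma>(t) c(t)\<^sup>p\<close> with \<open>c(t)\<close> of angle \<open>\<theta> + \<delta>(t)\<close>; both \<open>\<sigma>\<close> and \<open>\<delta>\<close> are differentiable at \<open>0\<close> since
  they can be recovered from the pairings of the curve with \<open>c\<^sup>p\<close> and its angular derivative.
\<close>

lemma tangent_space_orthogonal:
  assumes p: "1 \<le> p" and s: "s \<noteq> 0"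
    and y: "angular p 0 y \<theta> = 0" "angular p 1 y \<theta> = 0"
    and w: "w \<in> tangent_space (signed_powers p) (const2 s * circle \<theta> ^ p)"
  shows "bombieri_inner p y w = 0"
proof -
  obtain \<gamma> \<epsilon> where \<gamma>: "0 < \<epsilon>" "\<gamma> 0 = const2 s * circle \<theta> ^ p" "\<And>t. t \<in> {-\<epsilon><..<\<epsilon>} \<Longrightarrow> \<gamma> t \<in> signed_powers p"
    and vel: "\<And>\<alpha>. ((\<lambda>s. Poly_Mapping.lookup (\<gamma> s) \<alpha>) has_real_derivative Poly_Mapping.lookup w \<alpha>) (at 0)"
    using w unfolding tangent_space_def by blast
  have der: "((\<lambda>t. angular p n (\<gamma> t) \<theta>) has_real_derivative angular p n w \<theta>) (at 0)" for n
    unfolding angular_def by (intro DERIV_sum DERIV_cmult_right vel)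
  define A B where "A = (\<lambda>t. angular p 0 (\<gamma> t) \<theta>)" and "B = (\<lambda>t. angular p 1 (\<gamma> t) \<theta>)"
  \<comment> \<open>If the curve is \<rho> times the p-th power at angle \<theta> + d, then A =
    \<rho> cos^p d and B = p \<rho> cos^(p-1) d sin d, so \<open>m\<close> is tan d.\<close>
  define m where "m = (\<lambda>t. B t / (real p * A t))"
  have A0: "A 0 = s" and B0: "B 0 = 0"
    by (simp_all add: A_def B_def \<gamma>(2) angular_const2_mult angular_circle_power)
  obtain A' where A': "(A has_real_derivative A') (at 0)"
    using der[of 0] by (auto simp: A_def)
  obtain B' where B': "(B has_real_derivative B') (at 0)"
    using der[of 1] by (auto simp: B_def)
  have m0: "m 0 = 0"
    by (simp add: m_def B0)
  have "\<exists>m'. (m has_real_derivative m') (at 0)"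
    unfolding m_def using A' B' A0 s p by (intro exI) (auto intro!: derivative_eq_intros)
  then obtain m' where m': "(m has_real_derivative m') (at 0)"
    by blast
  define \<delta> where "\<delta> = (\<lambda>t. arctan (m t))"
  have \<delta>: "\<delta> 0 = 0"
    by (simp add: \<delta>_def m0)
  have "\<exists>\<delta>'. (\<delta> has_real_derivative \<delta>') (at 0)"
    unfolding \<delta>_def using m' by (intro exI) (rule DERIV_chain2[OF DERIV_arctan])
  then obtain \<delta>' where \<delta>': "(\<delta> has_real_derivative \<delta>') (at 0)"
    by blast
  define \<sigma> where "\<sigma> = (\<lambda>t. A t / cos (\<delta> t) ^ p)"
  have "\<exists>\<sigma>'. (\<sigma> has_real_derivative \<sigma>') (at 0)"
    unfolding \<sigma>_def using A' \<delta>' \<delta> by (intro exI) (auto intro!: derivative_eq_intros)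
  then obtain \<sigma>' where \<sigma>': "(\<sigma> has_real_derivative \<sigma>') (at 0)"
    by blast
  \<comment> \<open>\<open>Y\<close> vanishes at 0 together with its derivative, by the two
    conditions on y, so the product with \<open>\<sigma>\<close> has derivative 0 whatever the
    derivatives of \<open>\<sigma>\<close> and \<open>\<delta>\<close> are.\<close>
  define Y where "Y = (\<lambda>t. angular p 0 y (\<theta> + \<delta> t))"
  have "((\<lambda>t. \<theta> + \<delta> t) has_real_derivative 0 + \<delta>') (at 0)"
    by (intro DERIV_add DERIV_const \<delta>')
  from DERIV_chain2[OF DERIV_angular this, of p 0 y]
  have Y': "(Y has_real_derivative 0) (at 0)"
    using y(2) by (simp add: Y_def \<delta>)
  have Y0: "Y 0 = 0"
    using y(1) by (simp add: Y_def \<delta>)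
  have prod: "((\<lambda>t. \<sigma> t * Y t) has_real_derivative 0) (at 0)"
    using DERIV_mult[OF \<sigma>' Y'] Y0 by simp
  have eq: "bombieri_inner p y (\<gamma> t) = \<sigma> t * Y t" if t: "t \<in> {-\<epsilon><..<\<epsilon>}" "A t \<noteq> 0" for t
  proof -
    \<comment> \<open>The half-turn window is centred at \<theta>, so d lies in [-pi/2, pi/2). The
      left end is excluded by \<open>A t \<noteq> 0\<close>, and \<open>arctan\<close> then inverts
      \<open>tan\<close>.\<close>
    obtain \<rho> \<phi> where \<rho>: "\<rho> \<noteq> 0" "\<phi> \<in> {\<theta> - pi / 2..<\<theta> - pi / 2 + pi}" "\<gamma> t = const2 \<rho> * circle \<phi> ^ p"
      using signed_powersE[OF \<gamma>(3)[OF t(1)]] .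
    define d where "d = \<phi> - \<theta>"
    have At: "A t = \<rho> * cos d ^ p"
      by (simp add: A_def \<rho>(3) angular_const2_mult angular_circle_power d_def cos_diff mult.commute)
    have Bt: "B t = \<rho> * (real p * (cos d ^ (p - 1) * sin d))"
    proof -
      have "sin (\<theta> - \<phi>) = - sin d" "cos (\<theta> - \<phi>) = cos d"
        by (simp_all add: d_def sin_diff cos_diff)
      then show ?thesis
        by (simp add: B_def \<rho>(3) angular_const2_mult angular_circle_power)
    qed
    have c: "cos d \<noteq> 0"
      using t(2) p by (auto simp: At)
    have "d \<noteq> - (pi / 2)"
      using c by auto
    then have "- (pi / 2) < d" "d < pi / 2"
      using \<rho>(2) by (auto simp: d_def)
    moreover have "m t = tan d"
    proof -
      have "cos d ^ p = cos d ^ (p - 1) * cos d"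
        using p by (metis One_nat_def Suc_pred le_simps(3) power_Suc2 One_nat_def)
      then show ?thesis
        using c \<rho>(1) p by (simp add: m_def At Bt tan_def)
    qed
    ultimately have \<delta>t: "\<delta> t = d"
      by (simp add: \<delta>_def arctan_tan)
    have "bombieri_inner p y (\<gamma> t) = \<rho> * angular p 0 y \<phi>"
      by (simp add: \<rho>(3) bombieri_inner_const2_right bombieri_inner_circle_power)
    also have "\<dots> = \<sigma> t * Y t"
      using c by (simp add: \<sigma>_def Y_def \<delta>t At) (simp add: d_def)
    finally show ?thesis .
  qed
  have "\<forall>\<^sub>F t in nhds 0. A t \<noteq> 0"
  proof -
    have "isCont A 0"
      using A' by (rule DERIV_isCont)
    then show ?thesis
      using A0 s by (auto simp: isCont_def tendsto_at_iff_tendsto_nhds intro: tendsto_imp_eventually_ne)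
  qed
  moreover have "\<forall>\<^sub>F t in nhds 0. t \<in> {-\<epsilon><..<\<epsilon>}"
    using \<gamma>(1) by (intro eventually_nhds_in_open) auto
  ultimately have "\<forall>\<^sub>F t in nhds 0. bombieri_inner p y (\<gamma> t) = \<sigma> t * Y t"
    by eventually_elim (rule eq)
  then have "((\<lambda>t. bombieri_inner p y (\<gamma> t)) has_real_derivative 0) (at 0)"
    using prod by (subst DERIV_cong_ev[OF refl _ refl])
  moreover have "((\<lambda>t. bombieri_inner p y (\<gamma> t)) has_real_derivative bombieri_inner p y w) (at 0)"
    unfolding bombieri_inner_alt by (intro DERIV_sum DERIV_cmult DERIV_cdivide vel)
  ultimately show ?thesis
    by (rule DERIV_unique[symmetric])
qed

text \<open>The radial direction tests F(\<theta>) - s. The angular one tests F'(\<theta>) alone: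
  the derivative of cos^p vanishes at 0, so the point itself contributes nothing. Conversely these
  two conditions already give orthogonality to the velocity of every curve.\<close>

lemma critical_point_iff:
  assumes p: "1 \<le> p" and s: "s \<noteq> 0"
  shows "const2 s * circle \<theta> ^ p \<in> critical_points p (signed_powers p) v
    \<longleftrightarrow> s = angular p 0 v \<theta> \<and> angular p 1 v \<theta> = 0"
proof -
  define y where "y = v - const2 s * circle \<theta> ^ p"
  have y: "angular p 0 y \<theta> = angular p 0 v \<theta> - s" "angular p 1 y \<theta> = angular p 1 v \<theta>"
    by (simp_all add: y_def angular_minus angular_const2_mult angular_circle_power)
  have "const2 s * circle \<theta> ^ p \<in> critical_points p (signed_powers p) v
      \<longleftrightarrow> (\<forall>w\<in>tangent_space (signed_powers p) (const2 s * circle \<theta> ^ p). bombieri_inner p y w = 0)"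
    using signed_powersI[OF p s] by (simp add: critical_points_def y_def)
  also have "\<dots> \<longleftrightarrow> angular p 0 y \<theta> = 0 \<and> angular p 1 y \<theta> = 0"
  proof
    assume *: "\<forall>w\<in>tangent_space (signed_powers p) (const2 s * circle \<theta> ^ p). bombieri_inner p y w = 0"
    obtain w where "w \<in> tangent_space (signed_powers p) (const2 s * circle \<theta> ^ p)"
      "\<And>f. bombieri_inner p f w = s * angular p 1 f \<theta>"
      using angular_in_tangent_space[OF p s] by blast
    then have "angular p 1 y \<theta> = 0"
      using * s by (metis mult_eq_0_iff)
    then show "angular p 0 y \<theta> = 0 \<and> angular p 1 y \<theta> = 0"
      using bspec[OF * radial_in_tangent_space[OF p s]] by (simp add: bombieri_inner_circle_power)
  qed (use tangent_space_orthogonal[OF p s] in blast)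
  finally show ?thesis
    using y by auto
qed

text \<open>The factor s of a critical point is forced to be F(\<theta>), so \<theta> parametrises
  the critical points; F(\<theta>) \<noteq> 0 reflects the removal of 0 from the cone. A bijection
  of sets settles infinite counts too.\<close>

lemma num_critical_points_eq:
  assumes p: "1 \<le> p"
  shows "num_critical_points p v
    = emeasure (count_space UNIV) {\<theta>\<in>{0..<pi}. angular p 1 v \<theta> = 0 \<and> angular p 0 v \<theta> \<noteq> 0}"
proof -
  define Z where "Z = {\<theta>\<in>{0..<pi}. angular p 1 v \<theta> = 0 \<and> angular p 0 v \<theta> \<noteq> 0}"
  define \<Phi> where "\<Phi> = (\<lambda>\<theta>. const2 (angular p 0 v \<theta>) * circle \<theta> ^ p)"
  have inj: "inj_on \<Phi> Z"
  proof (rule inj_onI)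
    fix \<theta> \<phi>
    assume "\<theta> \<in> Z" "\<phi> \<in> Z" "\<Phi> \<theta> = \<Phi> \<phi>"
    then show "\<theta> = \<phi>"
      using const2_circle_power_inj[OF p, of "angular p 0 v \<theta>" "angular p 0 v \<phi>" \<theta> 0 \<phi>]
      by (simp add: Z_def \<Phi>_def)
  qed
  have "critical_points p (signed_powers p) v = \<Phi> ` Z"
  proof (intro equalityI subsetI)
    fix x
    assume x: "x \<in> critical_points p (signed_powers p) v"
    then have "x \<in> signed_powers p"
      by (simp add: critical_points_def)
    then obtain s \<theta> where "s \<noteq> 0" "\<theta> \<in> {0..<0 + pi}" "x = const2 s * circle \<theta> ^ p"
      by (rule signed_powersE)
    then show "x \<in> \<Phi> ` Z"
      using x critical_point_iff[OF p, of s \<theta> v] by (auto simp: \<Phi>_def Z_def)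
  next
    fix x
    assume "x \<in> \<Phi> ` Z"
    then show "x \<in> critical_points p (signed_powers p) v"
      using critical_point_iff[OF p] by (auto simp: \<Phi>_def Z_def)
  qed
  then show ?thesis
    unfolding num_critical_points_def Z_def[symmetric]
    using inj by (simp add: emeasure_count_space finite_image_iff card_image)
qed

lemma angular_expansion:
  assumes b: "bombieri_orthonormal_basis p b" and v: "v \<in> homogeneous_polys p"
  shows "angular p n v \<theta> = (\<Sum>i\<le>p. bombieri_inner p v (b i) * angular p n (b i) \<theta>)"
proof (induction n arbitrary: \<theta>)
  case 0
  show ?case
    using parseval[OF b v, of "circle \<theta> ^ p"]
    by (simp add: bombieri_inner_commute[of p "circle \<theta> ^ p"] bombieri_inner_circle_power)
next
  case (Suc n)
  have "((\<lambda>\<theta>. \<Sum>i\<le>p. bombieri_inner p v (b i) * angular p n (b i) \<theta>) has_real_derivative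
      (\<Sum>i\<le>p. bombieri_inner p v (b i) * angular p (Suc n) (b i) \<theta>)) (at \<theta>)"
    by (intro DERIV_sum DERIV_cmult DERIV_angular)
  then show ?case
    using DERIV_angular[of p n v \<theta>] unfolding Suc.IH[abs_def] by (rule DERIV_unique[symmetric])
qed

theorem theorem4p4:
  fixes p :: nat and M :: "'a measure" and v :: "'a \<Rightarrow> poly2"
  assumes "p \<ge> 1"
    and "bombieri_standard_gaussian p M v"
  shows "(\<lambda>\<omega>. num_critical_points p (v \<omega>)) \<in> borel_measurable M \<and>
    (\<integral>\<^sup>+ \<omega>. num_critical_points p (v \<omega>) \<partial>M) = ennreal (sqrt (3 * real p - 2))"
proof -
  note p = assms(1)
  obtain b where b: "bombieri_orthonormal_basis p b"
    and prob: "prob_space M" and v: "\<And>\<omega>. \<omega> \<in> space M \<Longrightarrow> v \<omega> \<in> homogeneous_polys p"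
    and indep: "prob_space.indep_vars M (\<lambda>_. borel) (\<lambda>i \<omega>. bombieri_inner p (v \<omega>) (b i)) {..p}"
    and normal: "\<And>i. i \<le> p \<Longrightarrow> distributed M lborel (\<lambda>\<omega>. bombieri_inner p (v \<omega>) (b i)) std_normal_density"
    using assms(2) unfolding bombieri_standard_gaussian_def by blast
  interpret prob_space M
    by (rule prob)
  interpret standard_normals M "{..p}" "\<lambda>i \<omega>. bombieri_inner p (v \<omega>) (b i)"
    using indep normal by unfold_locales auto
  define f where "f = (\<lambda>n i. angular p n (b i))"
  have gram: "(\<Sum>i\<le>p. f n i \<theta> * f m i \<phi>) = (- 1) ^ m * trig (n + m) p 0 (\<theta> - \<phi>)" for n m \<theta> \<phi>
    unfolding f_def by (rule covariance_angular[OF b])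
  note at_zero = trig_at_zero[OF p, unfolded One_nat_def]
  have der: "(f n i has_real_derivative f (Suc n) i \<theta>) (at \<theta>)" for n i \<theta>
    unfolding f_def by (rule DERIV_angular)
  have cont: "continuous_on UNIV (f n i)" for n i
    using der by (meson DERIV_isCont continuous_at_imp_continuous_on)
  \<comment> \<open>T = pi is the half-turn of angles. The variances are (-1)^n
    \<open>trig (2 * n) p 0 0\<close>, and \<open>R\<close> is the covariance of order (1, 1) at the
    angles \<theta> and \<theta> + \<delta>, which explains both of its minus signs.\<close>
  note count = expected_count_critical[where f = "f 0" and ?f1.0 = "f 1" and ?f2.0 = "f 2" and ?f3.0 = "f 3"
      and T = pi and ?A0.0 = 1 and ?A1.0 = "real p" and ?A2.0 = "real p * (3 * real p - 2)"
      and R = "\<lambda>\<delta>. - trig 2 p 0 (- \<delta>)" and L = "sqrt (3 * real p - 2)"]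
  define N where "N = (\<lambda>\<omega>. emeasure (count_space UNIV) {\<theta>\<in>{0..<pi}.
      (\<Sum>i\<le>p. bombieri_inner p (v \<omega>) (b i) * f 1 i \<theta>) = 0 \<and> (\<Sum>i\<le>p. bombieri_inner p (v \<omega>) (b i) * f 0 i \<theta>) \<noteq> 0})"
  have N: "N \<in> borel_measurable M \<and> (\<integral>\<^sup>+\<omega>. N \<omega> \<partial>M) = ennreal (sqrt (3 * real p - 2))"
    unfolding N_def
    by (intro conjI count)
      (use der[of 0] der[of 1] der[of 2] cont gram at_zero p curvature_limit[OF p] in \<open>simp_all add: numeral_eq_Suc\<close>)
  have eq: "num_critical_points p (v \<omega>) = N \<omega>" if "\<omega> \<in> space M" for \<omega>
    unfolding num_critical_points_eq[OF p] N_def f_def using angular_expansion[OF b v[OF that]] by simp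
  show ?thesis
    using N by (simp add: eq cong: measurable_cong nn_integral_cong)
qed

end
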